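(* Let $s, t, n$ be positive integers and define $m := \max\{t-1, 1\}$ if $s \in \{1,2\}$; $m := \sqrt{(s-2)n}$ if $s \geq 3$ and $t = 1$; and $m := 2\sqrt{(s-1)(t-1)n}$ otherwise. Then every $\mathcal{J}_{s,t}$-minor-free graph $G$ on $n$ vertices is isomorphic to a subgraph of $H \boxtimes K_{\lfloor m \rfloor}$ for some graph $H$ of treewidth at most $s$.
   Context: All graphs are finite, simple and undirected. $\mathcal{J}_{s,t}$ is the class of graphs whose vertex-set has a partition $A \cup B$ with $|A| = s$, $|B| = t$, $A$ a clique, every vertex of $A$ adjacent to every vertex of $B$, and $G[B]$ connected; $\mathcal{J}_{s,t}$-minor-free means containing no graph of $\mathcal{J}_{s,t}$ as a minor. The strong product $A \boxtimes B$ has vertex-set $V(A)\times V(B)$, where distinct $(v,x),(w,y)$ are adjacent if ($v=w$ and $xy\in E(B)$), or ($x=y$ and $vw\in E(A)$), or ($vw\in E(A)$ and $xy\in E(B)$). $K_m$ is the complete graph on $m$ vertices. *)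

theory Defs
  imports Complex_Main "Graph_Theory.Graph_Theory"
begin

text \<open>Finite simple undirected graphs are rendered by the locale predicate \<^const>\<open>pair_graph\<close>:
  finite, loop-free, symmetric, without parallel arcs. An edge \<open>uv\<close> is the pair of
  arcs \<open>(u,v)\<close> and \<open>(v,u)\<close>. The constant \<^const>\<open>Digraph_Component.connected\<close> excludes the null graph.\<close>

definition subgraph_up_to_iso :: "'a pair_pre_digraph \<Rightarrow> 'b pair_pre_digraph \<Rightarrow> bool" where
  "subgraph_up_to_iso G K \<longleftrightarrow>
    (\<exists>S :: 'b pair_pre_digraph. pair_graph S \<and> subgraph (with_proj S) (with_proj K) \<and>
       digraph_iso (with_proj G) (with_proj S))"

definition complete_graph :: "nat \<Rightarrow> nat pair_pre_digraph" where
  "complete_graph m = \<lparr>pverts = {..<m}, parcs = {(i, j). i < m \<and> j < m \<and> i \<noteq> j}\<rparr>"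

lemma complete_digraph_complete_graph: "complete_digraph m (with_proj (complete_graph m))"
  by (auto simp: complete_digraph_pair_def complete_graph_def)

definition strong_product ::
    "'a pair_pre_digraph \<Rightarrow> 'b pair_pre_digraph \<Rightarrow> ('a \<times> 'b) pair_pre_digraph"
    (infixl \<open>\<boxtimes>\<close> 70) where
  "A \<boxtimes> B = \<lparr>pverts = pverts A \<times> pverts B,
     parcs = {((v, x), (w, y)) | v x w y.
       (v, x) \<in> pverts A \<times> pverts B \<and> (w, y) \<in> pverts A \<times> pverts B \<and> (v, x) \<noteq> (w, y) \<and>
       (v = w \<and> (x, y) \<in> parcs B \<or>
        x = y \<and> (v, w) \<in> parcs A \<or>
        (v, w) \<in> parcs A \<and> (x, y) \<in> parcs B)}\<rparr>"

text \<open>Contracting the edge \<open>uv\<close> keeps \<open>u\<close> as the name of the merged vertex; the loop and the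
  parallel edges that arise are suppressed.\<close>

definition contract_edge :: "'a pair_pre_digraph \<Rightarrow> 'a \<Rightarrow> 'a \<Rightarrow> 'a pair_pre_digraph" where
  "contract_edge G u v = (let f = (\<lambda>w. if w = v then u else w) in
     \<lparr>pverts = f ` pverts G,
      parcs = {(f x, f y) | x y. (x, y) \<in> parcs G \<and> f x \<noteq> f y}\<rparr>)"

inductive contracts_to :: "'a pair_pre_digraph \<Rightarrow> 'a pair_pre_digraph \<Rightarrow> bool" where
  refl: "contracts_to G G"
| step: "contracts_to G H \<Longrightarrow> (u, v) \<in> parcs H \<Longrightarrow> contracts_to G (contract_edge H u v)"

definition minor :: "'b pair_pre_digraph \<Rightarrow> 'a pair_pre_digraph \<Rightarrow> bool" where
  "minor X G \<longleftrightarrow>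
    (\<exists>S Y :: 'a pair_pre_digraph. pair_graph S \<and> subgraph (with_proj S) (with_proj G) \<and>
       contracts_to S Y \<and> digraph_iso (with_proj X) (with_proj Y))"

definition J_class :: "nat \<Rightarrow> nat \<Rightarrow> 'a pair_pre_digraph set" where
  "J_class s t = {X. pair_graph X \<and>
     (\<exists>A B. pverts X = A \<union> B \<and> A \<inter> B = {} \<and> card A = s \<and> card B = t \<and>
        (\<forall>x\<in>A. \<forall>y\<in>A. x \<noteq> y \<longrightarrow> (x, y) \<in> parcs X) \<and>
        (\<forall>x\<in>A. \<forall>y\<in>B. (x, y) \<in> parcs X) \<and>
        Digraph_Component.connected (with_proj X \<restriction> B))}"

text \<open>Every finite graph has an isomorphic copy with vertices in \<^typ>\<open>nat\<close>, so it suffices to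
  let the excluded minors (and, below, the trees of tree-decompositions) range over such graphs.\<close>

definition J_minor_free :: "nat \<Rightarrow> nat \<Rightarrow> 'a pair_pre_digraph \<Rightarrow> bool" where
  "J_minor_free s t G \<longleftrightarrow> \<not> (\<exists>X \<in> (J_class s t :: nat pair_pre_digraph set). minor X G)"

text \<open>The library's \<^const>\<open>Digraph_Component.tree\<close> is not usable here: in a symmetric digraph every
  edge yields a directed cycle of length 2. Undirected cycles have length at least 3.\<close>

definition undirected_tree :: "'a pair_pre_digraph \<Rightarrow> bool" where
  "undirected_tree T \<longleftrightarrow> pair_graph T \<and> Digraph_Component.connected (with_proj T) \<and>
     \<not> (\<exists>p. pre_digraph.cycle (with_proj T) p \<and> length p \<ge> 3)"

definition tree_decomposition ::
    "'a pair_pre_digraph \<Rightarrow> 'b pair_pre_digraph \<Rightarrow> ('b \<Rightarrow> 'a set) \<Rightarrow> bool" where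
  "tree_decomposition G T \<beta> \<longleftrightarrow> undirected_tree T \<and>
     (\<forall>x \<in> pverts T. \<beta> x \<subseteq> pverts G) \<and>
     (\<forall>(u, v) \<in> parcs G. \<exists>x \<in> pverts T. u \<in> \<beta> x \<and> v \<in> \<beta> x) \<and>
     (\<forall>v \<in> pverts G. Digraph_Component.connected (with_proj T \<restriction> {x \<in> pverts T. v \<in> \<beta> x}))"

definition td_width :: "'b pair_pre_digraph \<Rightarrow> ('b \<Rightarrow> 'a set) \<Rightarrow> int" where
  "td_width T \<beta> = int (Max ((\<lambda>x. card (\<beta> x)) ` pverts T)) - 1"

text \<open>For a finite graph the set below is nonempty (put all vertices into one bag) and bounded below
  by \<open>-1\<close>, so the infimum is a minimum. The null graph has treewidth \<open>-1\<close>.\<close>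

definition treewidth :: "'a pair_pre_digraph \<Rightarrow> int" where
  "treewidth G =
     Inf {td_width T \<beta> | (T :: nat pair_pre_digraph) \<beta>. tree_decomposition G T \<beta>}"

end

theory Submission
  imports Defs
begin

text \<open>Vertices are assigned to parts one part at a time. Every component \<open>C\<close> of the unassigned
  vertices sees at most \<open>s\<close> parts, these parts are pairwise adjacent in the graph \<open>H\<close> built so far,
  and outside \<open>C\<close> there is a complete-graph model whose branch sets contain the vertices of these parts
  adjacent to \<open>C\<close>. Let \<open>A i\<close> be the set of neighbours in \<open>C\<close> of the \<open>i\<close>-th of these parts.
  If fewer than \<open>s\<close> parts are seen, a small connected set meeting all \<open>A i\<close> is a valid new part and a new
  branch set. A small set \<open>Z\<close> such that no component of \<open>C - Z\<close> meets all \<open>A i\<close> is also a valid new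
  part: a component of \<open>C - Z\<close> misses some \<open>A k\<close>, and if \<open>Z\<close> is minimal, then the \<open>k\<close>-th branch set can
  absorb \<open>Z\<close>. If \<open>s\<close> parts are seen, then \<open>t\<close> disjoint connected subsets of \<open>C\<close> that meet all \<open>A i\<close>
  would give a forbidden minor. Small sets come from the Alon--Seymour--Thomas lemma for \<open>s \<ge> 3\<close> and
  from Menger's theorem for \<open>s = 2\<close>. Since each new part sees a clique of \<open>H\<close>, the order of creation
  is an elimination order of \<open>H\<close> and bounds its treewidth.\<close>

section \<open>Connected vertex sets\<close>

text \<open>The obstacle is a component that already sees \<open>s\<close> parts: a further branch
  set could let a later component see \<open>s + 1\<close>. A separator \<open>Z\<close> avoids
  this, since a component of \<open>C - Z\<close> that misses \<open>A k\<close> no longer sees part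
  \<open>k\<close>, and the new part takes its place. Hence branch sets are chosen anew for each
  component and need to contain only the vertices of a part adjacent to it.

  Constants: for \<open>d + 1\<close> sets \<open>A i\<close> the layers live in \<open>d\<close>
  copies of \<open>C\<close>, so one of \<open>q + 1\<close> layers has at most d |C| / (q + 1)
  vertices. With fewer than \<open>s\<close> seen parts, \<open>d <= s - 2\<close> and
  \<open>q = M\<close> give a separator of size at most \<open>M\<close> once (s - 2) n < (M + 1)^2;
  this is the source of sqrt((s - 2) n). With \<open>s\<close> seen parts, at most
  \<open>t - 1\<close> disjoint hitting sets of size \<open>q\<close> are deleted first, and the
  separator has at most (t - 1) q + (s - 1) n / (q + 1) vertices; balancing gives 2 sqrt((s - 1)(t -
  1) n). For \<open>t = 1\<close> the component itself is a packing, so only the first bound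
  remains. For \<open>s <= 2\<close>, fewer than \<open>s\<close> seen parts are hit by a single
  vertex, and \<open>t - 1\<close> bounds the separators.\<close>

definition closed_in :: "'a rel \<Rightarrow> 'a set \<Rightarrow> 'a set \<Rightarrow> bool" where
  "closed_in E S R \<longleftrightarrow> R \<subseteq> S \<and> (\<forall>x\<in>R. \<forall>y\<in>S. (x, y) \<in> E \<longrightarrow> y \<in> R)"

text \<open>Connectedness as the absence of a proper nonempty closed subset: unions, images and
  crossing arcs are then handled by inspecting one closed set, without walks.\<close>

definition connected_in :: "'a rel \<Rightarrow> 'a set \<Rightarrow> bool" where
  "connected_in E S \<longleftrightarrow> S \<noteq> {} \<and> (\<forall>R. closed_in E S R \<and> R \<noteq> {} \<longrightarrow> R = S)"

definition is_component :: "'a rel \<Rightarrow> 'a set \<Rightarrow> 'a set \<Rightarrow> bool" where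
  "is_component E S C \<longleftrightarrow> closed_in E S C \<and> connected_in E C"

lemma connected_in_nonempty: "connected_in E S \<Longrightarrow> S \<noteq> {}"
  by (simp add: connected_in_def)

lemma connected_in_closed_eq:
  "connected_in E S \<Longrightarrow> closed_in E S R \<Longrightarrow> R \<noteq> {} \<Longrightarrow> R = S"
  by (simp add: connected_in_def)

text \<open>Otherwise \<open>S \<inter> R\<close> would be a proper nonempty closed subset of
  \<open>S\<close>. This is how connectedness is mostly exploited below.\<close>

lemma connected_in_crossing:
  assumes "connected_in E S" "x \<in> S" "x \<in> R" "y \<in> S" "y \<notin> R"
  obtains u v where "u \<in> S" "u \<in> R" "v \<in> S" "v \<notin> R" "(u, v) \<in> E"
proof (rule ccontr)
  assume "\<not> thesis"
  then have "closed_in E S (S \<inter> R)" using that by (auto simp: closed_in_def)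
  then have "S \<inter> R = S" using assms by (intro connected_in_closed_eq) auto
  then show False using assms by auto
qed

lemma connected_in_singleton [simp]: "connected_in E {x}"
  by (auto simp: connected_in_def closed_in_def)

lemma connected_in_Un:
  assumes P: "connected_in E P" and Q: "connected_in E Q" and "P \<inter> Q \<noteq> {}"
  shows "connected_in E (P \<union> Q)"
  unfolding connected_in_def
proof (intro conjI allI impI)
  fix R assume R: "closed_in E (P \<union> Q) R \<and> R \<noteq> {}"
  have cl: "closed_in E P (R \<inter> P)" "closed_in E Q (R \<inter> Q)"
    using R by (auto simp: closed_in_def)
  have "R \<inter> P \<noteq> {} \<Longrightarrow> R \<inter> P = P" "R \<inter> Q \<noteq> {} \<Longrightarrow> R \<inter> Q = Q"
    using connected_in_closed_eq[OF P cl(1)] connected_in_closed_eq[OF Q cl(2)] by auto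
  then show "R = P \<union> Q" using R assms(3) unfolding closed_in_def by blast
qed (use assms in auto)

lemma connected_in_edge: "sym E \<Longrightarrow> (x, y) \<in> E \<Longrightarrow> connected_in E {x, y}"
  by (auto simp: connected_in_def closed_in_def dest: symD)

lemma connected_in_Un_edge:
  assumes "sym E" "connected_in E P" "connected_in E Q" "x \<in> P" "y \<in> Q" "(x, y) \<in> E"
  shows "connected_in E (P \<union> Q)"
proof -
  have "connected_in E (P \<union> {x, y})"
    using assms(2) connected_in_edge[OF assms(1,6)] by (rule connected_in_Un) (use assms(4) in auto)
  moreover have "P \<union> Q = (P \<union> {x, y}) \<union> Q" using assms(4,5) by auto
  ultimately show ?thesis using connected_in_Un[of E "P \<union> {x, y}" Q] assms(3,5) by auto
qed

lemma connected_in_insert: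
  assumes "sym E" "connected_in E P" "x \<in> P" "(x, y) \<in> E"
  shows "connected_in E (insert y P)"
  using connected_in_Un_edge[OF assms(1,2) connected_in_singleton assms(3) singletonI assms(4)]
  by simp

lemma connected_in_mono:
  assumes "connected_in E S" "E \<subseteq> F"
  shows "connected_in F S"
proof -
  have "closed_in E S R" if "closed_in F S R" for R
    using that assms(2) unfolding closed_in_def by blast
  then show ?thesis using assms(1) by (simp add: connected_in_def)
qed

text \<open>The preimage of a closed set is closed. Arcs may collapse under \<open>h\<close>, as
  they do in contractions.\<close>

lemma connected_in_image:
  assumes "connected_in E S"
    and "\<And>x y. x \<in> S \<Longrightarrow> y \<in> S \<Longrightarrow> (x, y) \<in> E \<Longrightarrow> h x = h y \<or> (h x, h y) \<in> F"
  shows "connected_in F (h ` S)"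
  unfolding connected_in_def
proof (intro conjI allI impI)
  fix R assume R: "closed_in F (h ` S) R \<and> R \<noteq> {}"
  then have "R \<subseteq> h ` S" "R \<noteq> {}" by (auto simp: closed_in_def)
  then obtain x where "x \<in> S" "h x \<in> R" by blast
  moreover have "closed_in E S {x \<in> S. h x \<in> R}"
    unfolding closed_in_def
  proof (intro conjI ballI impI)
    fix x y assume "x \<in> {x \<in> S. h x \<in> R}" "y \<in> S" "(x, y) \<in> E"
    then show "y \<in> {x \<in> S. h x \<in> R}"
      using assms(2)[of x y] R unfolding closed_in_def by auto
  qed auto
  ultimately have "{x \<in> S. h x \<in> R} = S"
    using connected_in_closed_eq[OF assms(1)] by blast
  then show "R = h ` S" using R by (auto simp: closed_in_def)
qed (use assms(1) in \<open>simp add: connected_in_def\<close>)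

lemma connected_in_restrict: "connected_in (E \<inter> S \<times> S) S \<longleftrightarrow> connected_in E S"
  by (auto simp: connected_in_def closed_in_def)

section \<open>Components of a vertex set\<close>

lemma is_component_nonempty: "is_component E S C \<Longrightarrow> C \<noteq> {}"
  by (auto simp: is_component_def connected_in_def)

lemma is_component_subset: "is_component E S C \<Longrightarrow> C \<subseteq> S"
  by (auto simp: is_component_def closed_in_def)

lemma is_component_connected: "is_component E S C \<Longrightarrow> connected_in E C"
  by (auto simp: is_component_def)

lemma is_component_step:
  "is_component E S C \<Longrightarrow> x \<in> C \<Longrightarrow> y \<in> S \<Longrightarrow> (x, y) \<in> E \<Longrightarrow> y \<in> C"
  by (auto simp: is_component_def closed_in_def)

lemma is_component_absorb:
  assumes "is_component E S C" "connected_in E Q" "Q \<subseteq> S" "Q \<inter> C \<noteq> {}"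
  shows "Q \<subseteq> C"
proof -
  have "closed_in E Q (Q \<inter> C)" using assms by (auto simp: is_component_def closed_in_def)
  then show ?thesis using connected_in_closed_eq[OF assms(2)] assms(4) by blast
qed

text \<open>\<open>C\<close> is the least closed set containing \<open>x\<close>. If
  \<open>R\<close> is closed in \<open>C\<close>, then by symmetry so is \<open>C - R\<close>, and
  minimality forces the one of the two that contains \<open>x\<close> to be all of
  \<open>C\<close>.\<close>

lemma component_exists:
  assumes "sym E" "x \<in> S"
  obtains C where "is_component E S C" "x \<in> C"
proof -
  define C where "C = \<Inter>{R. closed_in E S R \<and> x \<in> R}"
  have least: "C \<subseteq> R" if "closed_in E S R" "x \<in> R" for R using that by (auto simp: C_def)
  have "closed_in E S S" by (auto simp: closed_in_def)
  then have "C \<subseteq> S" using least assms(2) by blast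
  have x: "x \<in> C" by (auto simp: C_def)
  have step: "z \<in> C" if "y \<in> C" "z \<in> S" "(y, z) \<in> E" for y z
    using that by (auto simp: C_def closed_in_def)
  have "R = C" if R: "R \<subseteq> C" "R \<noteq> {}" "\<And>y z. y \<in> R \<Longrightarrow> z \<in> C \<Longrightarrow> (y, z) \<in> E \<Longrightarrow> z \<in> R" for R
  proof (cases "x \<in> R")
    case True
    have "closed_in E S R" using R(1,3) step \<open>C \<subseteq> S\<close> unfolding closed_in_def by blast
    then show ?thesis using least True R(1) by blast
  next
    case False
    have "z \<in> C - R" if "y \<in> C - R" "z \<in> S" "(y, z) \<in> E" for y z
      using step R(3)[of z y] that symD[OF assms(1)] by blast
    then have "closed_in E S (C - R)" using \<open>C \<subseteq> S\<close> unfolding closed_in_def by blast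
    then have "C \<subseteq> C - R" using least False x by blast
    then show ?thesis using R by blast
  qed
  then have "connected_in E C" using x unfolding connected_in_def closed_in_def by blast
  moreover have "closed_in E S C" using \<open>C \<subseteq> S\<close> step unfolding closed_in_def by blast
  ultimately show ?thesis using that x unfolding is_component_def by blast
qed

section \<open>The Alon--Seymour--Thomas separation lemma\<close>

definition hits :: "'i set \<Rightarrow> ('i \<Rightarrow> 'a set) \<Rightarrow> 'a set \<Rightarrow> bool" where
  "hits I A X \<longleftrightarrow> (\<forall>i\<in>I. X \<inter> A i \<noteq> {})"

text \<open>For two sets this is an ordinary separator as in Menger's theorem; a general index set
  lets the same notion serve for up to \<open>s\<close> seen parts.\<close>

definition separates :: "'a rel \<Rightarrow> 'a set \<Rightarrow> 'i set \<Rightarrow> ('i \<Rightarrow> 'a set) \<Rightarrow> 'a set \<Rightarrow> bool" where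
  "separates E C I A Z \<longleftrightarrow> Z \<subseteq> C \<and> (\<forall>Q. Q \<subseteq> C - Z \<and> connected_in E Q \<longrightarrow> \<not> hits I A Q)"


text \<open>The nodes at distance at most \<open>j\<close> from \<open>A 0\<close> in the graph made of \<open>d\<close> copies of the
  graph, where the copies of \<open>v\<close> at levels \<open>i\<close> and \<open>i + 1\<close> are joined if \<open>v \<in> A (i + 1)\<close>.\<close>

primrec level_ball :: "'a rel \<Rightarrow> 'a set \<Rightarrow> (nat \<Rightarrow> 'a set) \<Rightarrow> nat \<Rightarrow> nat \<Rightarrow> (nat \<times> 'a) set" where
  "level_ball E C A d 0 = {0} \<times> (A 0 \<inter> C)"
| "level_ball E C A d (Suc j) = level_ball E C A d j \<union>
     {(i, v). i < d \<and> v \<in> C \<and> (\<exists>u. (i, u) \<in> level_ball E C A d j \<and> (u, v) \<in> E)} \<union>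
     {(Suc i, v) | i v. Suc i < d \<and> (i, v) \<in> level_ball E C A d j \<and> v \<in> A (Suc i)}"

text \<open>\<open>X\<close> is the projection to \<open>C\<close> of a walk from level 0 to
  \<open>(i, v)\<close>. A step inside a level adds at most one vertex, and a step to level
  \<open>l + 1\<close> is possible only at a vertex of \<open>A (l + 1)\<close>, so reaching level
  \<open>i\<close> means having met \<open>A 0\<close>, ..., \<open>A i\<close>.\<close>

lemma level_ball_connected:
  assumes "sym E" "d \<ge> 1" "(i, v) \<in> level_ball E C A d j"
  shows "i < d \<and> v \<in> C \<and> (\<exists>X. finite X \<and> X \<subseteq> C \<and> v \<in> X \<and> connected_in E X \<and> card X \<le> Suc j \<and>
           (\<forall>l\<le>i. X \<inter> A l \<noteq> {}))"
  using assms(3)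
proof (induction j arbitrary: i v)
  case 0
  then show ?case using assms(2) by (auto intro!: exI[of _ "{v}"])
next
  case (Suc j)
  from Suc.prems consider
      "(i, v) \<in> level_ball E C A d j"
    | u where "i < d" "v \<in> C" "(i, u) \<in> level_ball E C A d j" "(u, v) \<in> E"
    | l where "i = Suc l" "Suc l < d" "(l, v) \<in> level_ball E C A d j" "v \<in> A (Suc l)"
    by auto
  then show ?case
  proof cases
    case 1
    show ?thesis using Suc.IH[OF 1] by (meson le_SucI)
  next
    case 2
    from Suc.IH[OF 2(3)] obtain X where X: "finite X" "X \<subseteq> C" "u \<in> X" "connected_in E X"
      "card X \<le> Suc j" "\<forall>l\<le>i. X \<inter> A l \<noteq> {}" by blast
    have "connected_in E (insert v X)" using connected_in_insert[OF assms(1) X(4,3) 2(4)] .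
    moreover have "card (insert v X) \<le> Suc (Suc j)" using X(1,5) by (simp add: card_insert_if)
    ultimately show ?thesis using X 2 by (intro conjI exI[of _ "insert v X"]) auto
  next
    case 3
    from Suc.IH[OF 3(3)] obtain X where X: "v \<in> C" "finite X" "X \<subseteq> C" "v \<in> X" "connected_in E X"
      "card X \<le> Suc j" "\<forall>k\<le>l. X \<inter> A k \<noteq> {}" by blast
    then show ?thesis using 3 by (intro conjI exI[of _ X]) (auto simp: le_Suc_eq)
  qed
qed

lemma level_ball_mono: "i \<le> j \<Longrightarrow> level_ball E C A d i \<subseteq> level_ball E C A d j"
  by (rule lift_Suc_mono_le) auto

text \<open>The spheres \<open>L 0\<close>, ..., \<open>L q\<close> are disjoint subsets of a set
  with \<open>d * card C\<close> elements, so some \<open>L j\<close> is small; its projection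
  \<open>Z\<close> is the separator. A connected \<open>Q\<close> that avoids \<open>Z\<close> and
  meets all \<open>A i\<close> climbs all levels without leaving the ball of radius
  \<open>j - 1\<close>, and this exhibits a hitting set with at most \<open>j\<close> vertices. For
  \<open>d + 1\<close> sets there are \<open>d\<close> levels, because \<open>A 0\<close> is the
  source and \<open>A d\<close> the target.\<close>

lemma connected_hitting_set_or_separator:
  fixes A :: "nat \<Rightarrow> 'a set"
  assumes "finite C" "sym E" "d \<ge> 1"
  obtains (hit) X where "X \<subseteq> C" "connected_in E X" "card X \<le> q" "hits {..d} A X"
    | (sep) Z where "separates E C {..d} A Z" "card Z * Suc q \<le> d * card C"
proof -
  let ?R = "level_ball E C A d"
  define L where "L j = (case j of 0 \<Rightarrow> ?R 0 | Suc l \<Rightarrow> ?R (Suc l) - ?R l)" for j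
  have sub: "?R j \<subseteq> {..<d} \<times> C" for j
    using level_ball_connected[OF assms(2,3)] by auto
  have fin: "finite (?R j)" for j
    using sub by (rule finite_subset) (use assms(1) in auto)
  have sum: "(\<Sum>i\<le>j. card (L i)) = card (?R j)" for j
  proof (induction j)
    case (Suc j)
    have "card (L (Suc j)) = card (?R (Suc j)) - card (?R j)"
      unfolding L_def
      by (simp only: nat.case card_Diff_subset[OF fin level_ball_mono[OF le_SucI[OF order_refl]]])
    then show ?case
      using Suc card_mono[OF fin level_ball_mono[OF le_SucI[OF order_refl]], of j]
      by (simp del: level_ball.simps)
  qed (simp add: L_def)
  have "\<exists>j\<le>q. card (L j) * Suc q \<le> d * card C"
  proof (rule ccontr)
    assume "\<not> ?thesis"
    then have "(\<Sum>j\<le>q. d * card C) < (\<Sum>j\<le>q. card (L j) * Suc q)"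
      by (intro sum_strict_mono) auto
    also have "\<dots> = card (?R q) * Suc q" by (simp only: sum sum_distrib_right[symmetric])
    also have "\<dots> \<le> (d * card C) * Suc q"
      using card_mono[OF _ sub, of q] assms(1) by (intro mult_right_mono) auto
    finally show False by simp
  qed
  then obtain j where j: "j \<le> q" "card (L j) * Suc q \<le> d * card C" by blast
  define Z where "Z = snd ` L j"
  have LR: "L j \<subseteq> ?R j" by (auto simp: L_def split: nat.splits)
  have "Z \<subseteq> C" using LR sub[of j] by (auto simp: Z_def)
  moreover have "card Z * Suc q \<le> d * card C"
    using j(2) card_image_le[of "L j" snd] finite_subset[OF LR fin] unfolding Z_def
    by (meson le_trans mult_le_mono1)
  moreover have "\<exists>X\<subseteq>C. connected_in E X \<and> card X \<le> q \<and> hits {..d} A X"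
    if Q: "Q \<subseteq> C - Z" "connected_in E Q" "hits {..d} A Q" for Q
  proof -
    have notL: "(i, v) \<notin> L j" if "v \<in> Q" for i v
      using that Q(1) by (force simp: Z_def)
    obtain a0 where a0: "a0 \<in> Q" "a0 \<in> A 0" using Q(3) by (auto simp: hits_def)
    have a0R: "(0, a0) \<in> ?R l" for l
      using a0 Q(1) level_ball_mono[of 0 l E C A d] by auto
    \<comment> \<open>Radius 0 is impossible: \<open>(0, a0)\<close> would lie in
      \<open>L 0\<close>, hence \<open>a0\<close> in \<open>Z\<close>.\<close>
    obtain l where l: "j = Suc l"
      using a0R[of 0] notL[OF a0(1)] by (cases j) (auto simp: L_def)
    \<comment> \<open>\<open>Q\<close> misses the sphere of radius \<open>Suc l\<close>, so whatever
      of \<open>Q\<close> lies in that ball is already in the smaller one.\<close>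
    have stay: "(i, v) \<in> ?R l" if "v \<in> Q" "(i, v) \<in> ?R (Suc l)" for i v
      using notL[OF that(1)] that(2) unfolding l L_def by auto
    have spread: "{i} \<times> Q \<subseteq> ?R l" if "i < d" "a \<in> Q" "(i, a) \<in> ?R l" for i a
    proof -
      have "closed_in E Q {v \<in> Q. (i, v) \<in> ?R l}"
        unfolding closed_in_def
      proof (intro conjI ballI impI)
        fix u v assume *: "u \<in> {v \<in> Q. (i, v) \<in> ?R l}" "v \<in> Q" "(u, v) \<in> E"
        then have "(i, v) \<in> ?R (Suc l)" using that(1) Q(1) by auto
        then show "v \<in> {v \<in> Q. (i, v) \<in> ?R l}" using stay *(2) by blast
      qed auto
      then have "{v \<in> Q. (i, v) \<in> ?R l} = Q"
        by (rule connected_in_closed_eq[OF Q(2)]) (use that in blast)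
      then show ?thesis by blast
    qed
    have full: "i < d \<Longrightarrow> {i} \<times> Q \<subseteq> ?R l" for i
    proof (induction i)
      case 0
      then show ?case using spread[OF _ a0(1)] a0R by blast
    next
      case (Suc i)
      obtain a where a: "a \<in> Q" "a \<in> A (Suc i)" using Q(3) Suc.prems by (force simp: hits_def)
      have "(i, a) \<in> ?R l" using Suc a by auto
      then have "(Suc i, a) \<in> ?R (Suc l)" using a Suc.prems by auto
      then show ?case using spread[OF Suc.prems a(1)] stay[OF a(1)] by blast
    qed
    obtain a where a: "a \<in> Q" "a \<in> A d" using Q(3) by (auto simp: hits_def)
    \<comment> \<open>At the top level a vertex of \<open>A d\<close> completes the hitting set;
      radius \<open>l\<close> gives at most \<open>Suc l = j <= q\<close> vertices.\<close>
    have "(d - 1, a) \<in> ?R l" using full[of "d - 1"] a(1) assms(3) by auto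
    from level_ball_connected[OF assms(2,3) this] obtain X where
      X: "X \<subseteq> C" "a \<in> X" "connected_in E X" "card X \<le> Suc l" "\<forall>l\<le>d - 1. X \<inter> A l \<noteq> {}" by blast
    have "X \<inter> A i \<noteq> {}" if "i \<le> d" for i
      using that X(2,5) a(2) by (cases "i = d") auto
    then show ?thesis
      using X j(1) l by (intro exI[of _ X]) (auto simp: hits_def)
  qed
  ultimately show ?thesis using that(1) that(2)[of Z] unfolding separates_def by blast
qed

text \<open>Greedy packing: delete the sets found so far, at most \<open>q\<close> vertices each,
  and apply the previous lemma to the rest. If this yields a separator, then together with the
  deleted vertices it separates \<open>C\<close>. The summand \<open>z\<close> is kept apart from
  \<open>p * q\<close> so that its bound stays a product inequality of naturals.\<close>

lemma disjoint_hitting_sets_or_separator: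
  fixes A :: "nat \<Rightarrow> 'a set"
  assumes "finite C" "sym E" "d \<ge> 1"
  obtains (hit) F where "finite F" "card F = Suc p" "pairwise disjnt F"
      "\<And>X. X \<in> F \<Longrightarrow> X \<subseteq> C \<and> connected_in E X \<and> card X \<le> q \<and> hits {..d} A X"
    | (sep) Z z where "separates E C {..d} A Z" "card Z \<le> p * q + z" "z * Suc q \<le> d * card C"
proof (induction p arbitrary: thesis)
  case 0
  show ?case
  proof (rule connected_hitting_set_or_separator[OF assms, of q A])
    fix X assume "X \<subseteq> C" "connected_in E X" "card X \<le> q" "hits {..d} A X"
    then show ?thesis by (intro "0.prems"(1)[of "{X}"]) (auto simp: pairwise_def)
  next
    fix Z assume "separates E C {..d} A Z" "card Z * Suc q \<le> d * card C"
    then show ?thesis by (intro "0.prems"(2)[of Z "card Z"]) auto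
  qed
next
  case (Suc p)
  show ?case
  proof (rule Suc.IH)
    fix F assume F: "finite F" "card F = Suc p" "pairwise disjnt F"
      "\<And>X. X \<in> F \<Longrightarrow> X \<subseteq> C \<and> connected_in E X \<and> card X \<le> q \<and> hits {..d} A X"
    have U: "card (\<Union>F) \<le> Suc p * q"
      using card_Union_le_sum_card[of F] sum_bounded_above[of F card q] F(2,4) by force
    have "\<Union>F \<subseteq> C" using F(4) by auto
    have "finite (C - \<Union>F)" using assms(1) by simp
    then show ?thesis
    proof (rule connected_hitting_set_or_separator[OF _ assms(2,3), of _ q A])
      fix X assume X: "X \<subseteq> C - \<Union>F" "connected_in E X" "card X \<le> q" "hits {..d} A X"
      have "X \<notin> F" using X(1) connected_in_nonempty[OF X(2)] by auto
      moreover have "pairwise disjnt (insert X F)"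
        using F(3) X(1) by (auto simp: pairwise_insert disjnt_def)
      ultimately show ?thesis using F X by (intro Suc.prems(1)[of "insert X F"]) auto
    next
      fix Z assume Z: "separates E (C - \<Union>F) {..d} A Z" "card Z * Suc q \<le> d * card (C - \<Union>F)"
      have "card Z * Suc q \<le> d * card C"
        using Z(2) assms(1) by (meson Diff_subset card_mono mult_le_mono2 order_trans)
      moreover have "card (\<Union>F \<union> Z) \<le> Suc p * q + card Z" using U card_Un_le[of "\<Union>F" Z] by linarith
      moreover have "separates E C {..d} A (\<Union>F \<union> Z)"
        using Z(1) \<open>\<Union>F \<subseteq> C\<close> unfolding separates_def by (auto simp: Diff_eq Int_assoc)
      ultimately show ?thesis by (intro Suc.prems(2)[of "\<Union>F \<union> Z" "card Z"])
    qed
  next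
    fix Z z assume "separates E C {..d} A Z" "card Z \<le> p * q + z" "z * Suc q \<le> d * card C"
    then show ?thesis by (intro Suc.prems(2)[of Z z]) auto
  qed
qed

section \<open>Menger's theorem\<close>

lemma hits_case_bool [simp]: "hits UNIV (case_bool A B) X \<longleftrightarrow> X \<inter> A \<noteq> {} \<and> X \<inter> B \<noteq> {}"
  by (auto simp: hits_def split: bool.splits)

lemma separates_commute:
  "separates E C UNIV (case_bool A B) Z \<longleftrightarrow> separates E C UNIV (case_bool B A) Z"
  by (auto simp: separates_def)

section \<open>Reachability expressed by connected sets\<close>

definition reach_avoiding :: "'a rel \<Rightarrow> 'a set \<Rightarrow> 'a set \<Rightarrow> 'a set" where
  "reach_avoiding E D A = \<Union>{X. X \<subseteq> D \<and> connected_in E X \<and> X \<inter> A \<noteq> {}}"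

lemma reach_avoidingI:
  "X \<subseteq> D \<Longrightarrow> connected_in E X \<Longrightarrow> X \<inter> A \<noteq> {} \<Longrightarrow> v \<in> X \<Longrightarrow> v \<in> reach_avoiding E D A"
  by (auto simp: reach_avoiding_def)

lemma reach_avoidingE:
  assumes "v \<in> reach_avoiding E D A"
  obtains X where "X \<subseteq> D" "connected_in E X" "X \<inter> A \<noteq> {}" "v \<in> X"
  using assms by (auto simp: reach_avoiding_def)

lemma reach_avoiding_subset: "reach_avoiding E D A \<subseteq> D"
  by (auto simp: reach_avoiding_def)

lemma reach_avoiding_base: "v \<in> A \<Longrightarrow> v \<in> D \<Longrightarrow> v \<in> reach_avoiding E D A"
  by (rule reach_avoidingI[of "{v}"]) auto

lemma reach_avoiding_step:
  assumes "sym E" "u \<in> reach_avoiding E D A" "(u, v) \<in> E" "v \<in> D"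
  shows "v \<in> reach_avoiding E D A"
proof -
  from assms(2) obtain X where X: "X \<subseteq> D" "connected_in E X" "X \<inter> A \<noteq> {}" "u \<in> X"
    by (rule reach_avoidingE)
  show ?thesis
    by (rule reach_avoidingI[OF _ connected_in_insert[OF assms(1) X(2,4) assms(3)]])
      (use X assms(4) in auto)
qed

lemma reach_avoiding_mono: "D \<subseteq> D' \<Longrightarrow> reach_avoiding E D A \<subseteq> reach_avoiding E D' A"
  unfolding reach_avoiding_def by (rule Union_mono) blast

text \<open>A common vertex would join a connected set meeting \<open>A\<close> to one meeting
  \<open>B\<close>, both inside \<open>C - S\<close>.\<close>

lemma separates_reach_avoiding_disjoint:
  assumes "separates E C UNIV (case_bool A B) S"
  shows "reach_avoiding E (C - S) A \<inter> reach_avoiding E (C - S) B = {}"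
proof -
  have False if v: "v \<in> reach_avoiding E (C - S) A" "v \<in> reach_avoiding E (C - S) B" for v
  proof -
    from v(1) obtain X where X: "X \<subseteq> C - S" "connected_in E X" "X \<inter> A \<noteq> {}" "v \<in> X"
      by (rule reach_avoidingE)
    from v(2) obtain Y where Y: "Y \<subseteq> C - S" "connected_in E Y" "Y \<inter> B \<noteq> {}" "v \<in> Y"
      by (rule reach_avoidingE)
    have "connected_in E (X \<union> Y)" using X Y by (intro connected_in_Un) auto
    then have "\<not> hits UNIV (case_bool A B) (X \<union> Y)"
      using assms X(1) Y(1) unfolding separates_def by (meson Un_subset_iff)
    then show False using X(3) Y(3) by auto
  qed
  then show ?thesis by blast
qed

text \<open>If \<open>S\<close> separates \<open>A\<close> from \<open>B\<close> once the edge \<open>xy\<close> is deleted, with \<open>y\<close> on the side of \<open>B\<close>,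
  then every \<open>A\<close>--\<open>B\<close> connection meets \<open>S \<union> {x}\<close> before it uses \<open>xy\<close>.\<close>

lemma separates_deleted_edge:
  assumes "sym E" "sym E'" "E \<subseteq> E' \<union> {(x, y), (y, x)}"
    and S: "separates E' C UNIV (case_bool A B) S"
    and y: "y \<in> reach_avoiding E' (C - S) B"
    and T: "separates E' C UNIV (case_bool A (insert x S)) T"
  shows "separates E C UNIV (case_bool A B) T"
  unfolding separates_def
proof (intro conjI allI impI)
  show "T \<subseteq> C" using T by (simp add: separates_def)
  fix Q assume Q: "Q \<subseteq> C - T \<and> connected_in E Q"
  show "\<not> hits UNIV (case_bool A B) Q"
  proof
    assume hit: "hits UNIV (case_bool A B) Q"
    let ?R = "reach_avoiding E' Q A"
    have RP: "?R \<inter> insert x S = {}"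
    proof (rule ccontr)
      assume "?R \<inter> insert x S \<noteq> {}"
      then obtain v where vR: "v \<in> ?R" and v: "v \<in> insert x S" by blast
      from vR obtain X where X: "X \<subseteq> Q" "connected_in E' X" "X \<inter> A \<noteq> {}" "v \<in> X"
        by (rule reach_avoidingE)
      then have "X \<subseteq> C - T" "hits UNIV (case_bool A (insert x S)) X" using v Q by auto
      then show False using T X(2) unfolding separates_def by blast
    qed
    have RA: "?R \<subseteq> reach_avoiding E' (C - S) A"
    proof
      fix v assume "v \<in> ?R"
      then obtain X where X: "X \<subseteq> Q" "connected_in E' X" "X \<inter> A \<noteq> {}" "v \<in> X"
        by (rule reach_avoidingE)
      have "X \<subseteq> ?R" using X by (auto intro: reach_avoidingI)
      then have "X \<subseteq> C - S" using RP X(1) Q by blast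
      then show "v \<in> reach_avoiding E' (C - S) A" using X by (auto intro: reach_avoidingI)
    qed
    note disj = separates_reach_avoiding_disjoint[OF S]
    \<comment> \<open>An arc of \<open>E\<close> outside \<open>E'\<close> joins \<open>x\<close>
      and \<open>y\<close>. Neither is in \<open>?R\<close>, which avoids \<open>insert x S\<close>
      and lies on the \<open>A\<close> side, whereas \<open>y\<close> lies on the \<open>B\<close>
      side. Hence \<open>?R\<close> is closed for \<open>E\<close> as well and fills
      \<open>Q\<close>.\<close>
    have "closed_in E Q ?R"
      unfolding closed_in_def
    proof (intro conjI ballI impI)
      fix u v assume uv: "u \<in> ?R" "v \<in> Q" "(u, v) \<in> E"
      have "u \<noteq> x" "u \<noteq> y" using uv(1) RP RA disj y by auto
      then have "(u, v) \<in> E'" using uv(3) assms(3) by auto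
      then show "v \<in> ?R" using reach_avoiding_step[OF assms(2)] uv by metis
    qed (rule reach_avoiding_subset)
    moreover have "?R \<noteq> {}" using hit by (auto intro: reach_avoiding_base)
    ultimately have RQ: "?R = Q" using Q by (intro connected_in_closed_eq) auto
    obtain b where "b \<in> Q" "b \<in> B" using hit by auto
    then have "b \<in> reach_avoiding E' (C - S) A" using RQ RA by blast
    moreover from this have "b \<in> reach_avoiding E' (C - S) B"
      using reach_avoiding_subset[of E' "C - S" A] by (intro reach_avoiding_base \<open>b \<in> B\<close>) blast
    ultimately show False using disj by blast
  qed
qed

text \<open>Keep \<open>p\<close> and one component of \<open>X - {p}\<close> that meets
  \<open>A\<close>; it is attached to \<open>p\<close> because \<open>X\<close> is connected. If
  \<open>p\<close> is in \<open>A\<close>, then \<open>{p}\<close> is enough.\<close>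

lemma connected_trim_end:
  assumes "sym E" "connected_in E X" "p \<in> X" "X \<inter> A \<noteq> {}"
  obtains Y where "Y \<subseteq> X" "p \<in> Y" "connected_in E Y" "Y \<inter> A \<noteq> {}"
    "Y - {p} \<subseteq> reach_avoiding E (X - {p}) A"
proof (cases "p \<in> A")
  case True
  show ?thesis by (rule that[of "{p}"]) (use assms True in auto)
next
  case False
  obtain a where a: "a \<in> X" "a \<in> A" "a \<noteq> p" using assms(4) False by blast
  obtain D where D: "is_component E (X - {p}) D" "a \<in> D"
    using component_exists[OF assms(1), of a "X - {p}"] a by auto
  have DX: "D \<subseteq> X - {p}" using D(1) by (rule is_component_subset)
  obtain u v where uv: "u \<in> X" "u \<in> D" "v \<in> X" "v \<notin> D" "(u, v) \<in> E"
    using connected_in_crossing[OF assms(2) a(1) D(2) assms(3)] DX by blast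
  have "v = p" using is_component_step[OF D(1) uv(2) _ uv(5)] uv(3,4) by blast
  then have "connected_in E (insert p D)"
    using connected_in_insert[OF assms(1) is_component_connected[OF D(1)] uv(2)] uv(5) by simp
  moreover have "D \<subseteq> reach_avoiding E (X - {p}) A"
    using DX D a is_component_connected[OF D(1)] by (auto intro: reach_avoidingI)
  ultimately show ?thesis using DX D(2) a assms(3) by (intro that[of "insert p D"]) auto
qed

text \<open>As \<open>F\<close> is disjoint and as large as \<open>P\<close>, each member meets
  \<open>P\<close> in exactly one vertex, and \<open>P\<close> can index the family. After trimming,
  everything except the end point \<open>p\<close> is reached from \<open>A\<close> without touching
  \<open>P\<close>; this later keeps the pieces from the two sides disjoint.\<close>

lemma linkage_by_endpoints:
  assumes "sym E" "finite P" "card F = card P" "finite F" "pairwise disjnt F"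
    and F: "\<And>X. X \<in> F \<Longrightarrow> X \<subseteq> C \<and> connected_in E X \<and> X \<inter> A \<noteq> {} \<and> X \<inter> P \<noteq> {}"
  obtains g where "\<And>p. p \<in> P \<Longrightarrow> p \<in> g p \<and> g p \<subseteq> C \<and> connected_in E (g p) \<and> g p \<inter> A \<noteq> {}"
    "\<And>p q. p \<in> P \<Longrightarrow> q \<in> P \<Longrightarrow> p \<noteq> q \<Longrightarrow> g p \<inter> g q = {}"
    "\<And>p. p \<in> P \<Longrightarrow> g p - {p} \<subseteq> reach_avoiding E (C - P) A"
proof -
  obtain h where h: "\<And>X. X \<in> F \<Longrightarrow> h X \<in> X \<inter> P"
    using F bchoice[of F "\<lambda>X p. p \<in> X \<inter> P"] by blast
  have "inj_on h F"
  proof (rule inj_onI, rule ccontr)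
    fix X Y assume "X \<in> F" "Y \<in> F" "h X = h Y" "X \<noteq> Y"
    then show False using assms(5) h[of X] h[of Y] by (auto simp: pairwise_def disjnt_def)
  qed
  moreover have "h ` F \<subseteq> P" using h by auto
  ultimately have "h ` F = P" using assms(2,3) by (metis card_image card_subset_eq)
  then have "\<forall>p\<in>P. \<exists>X\<in>F. h X = p" by blast
  then obtain k where k: "\<And>p. p \<in> P \<Longrightarrow> k p \<in> F \<and> h (k p) = p" by metis
  have pk: "p \<in> k p" if "p \<in> P" for p using h k that by (metis IntD1)
  have disj: "k p \<inter> k q = {}" if "p \<in> P" "q \<in> P" "p \<noteq> q" for p q
  proof -
    have "k p \<noteq> k q" using k that by metis
    then show ?thesis using assms(5) k[OF that(1)] k[OF that(2)] by (auto simp: pairwise_def disjnt_def)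
  qed
  have "\<exists>Y. Y \<subseteq> k p \<and> p \<in> Y \<and> connected_in E Y \<and> Y \<inter> A \<noteq> {} \<and>
      Y - {p} \<subseteq> reach_avoiding E (k p - {p}) A" if "p \<in> P" for p
  proof -
    have "connected_in E (k p)" "k p \<inter> A \<noteq> {}" using F k that by blast+
    then show ?thesis using connected_trim_end[OF assms(1) _ pk[OF that]] by metis
  qed
  then obtain g where g: "\<And>p. p \<in> P \<Longrightarrow> g p \<subseteq> k p \<and> p \<in> g p \<and> connected_in E (g p) \<and> g p \<inter> A \<noteq> {} \<and>
      g p - {p} \<subseteq> reach_avoiding E (k p - {p}) A" by metis
  show ?thesis
  proof (rule that)
    fix p assume p: "p \<in> P"
    have kC: "k p \<subseteq> C" using F k p by blast
    show "p \<in> g p \<and> g p \<subseteq> C \<and> connected_in E (g p) \<and> g p \<inter> A \<noteq> {}"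
      using g[OF p] kC by (meson order_trans)
    have "k p - {p} \<subseteq> C - P"
    proof
      fix v assume v: "v \<in> k p - {p}"
      then have "v \<notin> P" using disj[OF p, of v] pk by blast
      then show "v \<in> C - P" using v kC by blast
    qed
    then show "g p - {p} \<subseteq> reach_avoiding E (C - P) A"
      using g[OF p] reach_avoiding_mono by (meson order_trans)
  next
    fix p q assume "p \<in> P" "q \<in> P" "p \<noteq> q"
    then show "g p \<inter> g q = {}" using disj g by blast
  qed
qed

text \<open>Induction by deleting an edge \<open>ab\<close>. If the deletion creates a separator
  \<open>S\<close> with fewer than \<open>t\<close> vertices, then \<open>insert x S\<close>, for an
  end \<open>x\<close> of the edge, separates in \<open>E\<close>, so \<open>card S = t - 1\<close>.
  Induction links \<open>A\<close> to \<open>insert x S\<close> and \<open>B\<close> to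
  \<open>insert y S\<close> by \<open>t\<close> disjoint sets each; these are glued at the vertices
  of \<open>S\<close> and along the edge \<open>xy\<close>.\<close>

lemma menger:
  assumes "finite E" "sym E" "finite C"
    and "\<And>Z. separates E C UNIV (case_bool A B) Z \<Longrightarrow> t \<le> card Z"
  shows "\<exists>F. finite F \<and> card F = t \<and> pairwise disjnt F \<and>
    (\<forall>X\<in>F. X \<subseteq> C \<and> connected_in E X \<and> X \<inter> A \<noteq> {} \<and> X \<inter> B \<noteq> {})"
  using assms(1,2,4)
proof (induction "card E" arbitrary: E A B rule: less_induct)
  case less
  show ?case
  proof (cases "E = {}")
    case True
    have "separates E C UNIV (case_bool A B) (A \<inter> B \<inter> C)"
      unfolding separates_def
    proof (intro conjI allI impI)
      fix Q assume Q: "Q \<subseteq> C - A \<inter> B \<inter> C \<and> connected_in E Q"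
      then obtain q where "q \<in> Q" using connected_in_nonempty by blast
      then have "{q} = Q"
        using Q True by (intro connected_in_closed_eq[of E Q]) (auto simp: closed_in_def)
      then show "\<not> hits UNIV (case_bool A B) Q" using Q by auto
    qed auto
    then have "t \<le> card (A \<inter> B \<inter> C)" using less.prems(3) by blast
    then obtain T where T: "T \<subseteq> A \<inter> B \<inter> C" "card T = t" "finite T"
      by (meson obtain_subset_with_card_n)
    then show ?thesis
      by (intro exI[of _ "(\<lambda>v. {v}) ` T"])
        (auto simp: card_image inj_on_def pairwise_def)
  next
    case False
    then obtain a b where ab: "(a, b) \<in> E" by auto
    define E' where "E' = E - {(a, b), (b, a)}"
    have E': "finite E'" "sym E'" "card E' < card E" "E' \<subseteq> E"
      using less.prems(1,2) ab unfolding E'_def sym_def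
      by (auto intro!: psubset_card_mono)
    show ?thesis
    proof (cases "\<forall>Z. separates E' C UNIV (case_bool A B) Z \<longrightarrow> t \<le> card Z")
      case True
      then obtain F where "finite F" "card F = t" "pairwise disjnt F"
        "\<forall>X\<in>F. X \<subseteq> C \<and> connected_in E' X \<and> X \<inter> A \<noteq> {} \<and> X \<inter> B \<noteq> {}"
        using less.hyps[OF E'(3,1,2), of A B] by blast
      then show ?thesis using connected_in_mono[OF _ E'(4)] by (intro exI[of _ F]) auto
    next
      case False
      then obtain S where S: "separates E' C UNIV (case_bool A B) S" "card S < t" by auto
      let ?RA = "reach_avoiding E' (C - S) A" and ?RB = "reach_avoiding E' (C - S) B"
      note disj = separates_reach_avoiding_disjoint[OF S(1)]
      have finS: "finite S" using S(1) assms(3) finite_subset by (auto simp: separates_def)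
      \<comment> \<open>The arcs by which \<open>Q\<close> leaves the two sides are both deleted
        arcs. They start on different sides, so each is the reverse of the other, and the edge runs
        from the \<open>A\<close> side to the \<open>B\<close> side.\<close>
      have cross: "\<exists>u v. u \<in> Q \<and> v \<in> Q \<and> u \<in> ?RA \<and> v \<in> ?RB \<and> (u, v) \<in> {(a, b), (b, a)}"
        if Q: "Q \<subseteq> C - S" "connected_in E Q" "hits UNIV (case_bool A B) Q" for Q
      proof -
        from Q(3) obtain p q where pq: "p \<in> Q" "p \<in> A" "q \<in> Q" "q \<in> B" by auto
        then have "p \<in> ?RA" "q \<in> ?RB" using Q(1) by (auto intro: reach_avoiding_base)
        then have "q \<notin> ?RA" "p \<notin> ?RB" using disj by auto
        obtain u v where uv: "u \<in> Q" "u \<in> ?RA" "v \<in> Q" "v \<notin> ?RA" "(u, v) \<in> E"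
          using connected_in_crossing[OF Q(2) pq(1) \<open>p \<in> ?RA\<close> pq(3) \<open>q \<notin> ?RA\<close>] .
        obtain u' v' where uv': "u' \<in> Q" "u' \<in> ?RB" "v' \<in> Q" "v' \<notin> ?RB" "(u', v') \<in> E"
          using connected_in_crossing[OF Q(2) pq(3) \<open>q \<in> ?RB\<close> pq(1) \<open>p \<notin> ?RB\<close>] .
        have "(u, v) \<notin> E'" "(u', v') \<notin> E'"
          using reach_avoiding_step[OF E'(2)] uv uv' Q(1) by (meson subsetD)+
        then have "(u, v) \<in> {(a, b), (b, a)}" "(u', v') \<in> {(a, b), (b, a)}"
          using uv(5) uv'(5) unfolding E'_def by blast+
        moreover have "u \<noteq> u'" using uv(2) uv'(2) disj by auto
        ultimately have "u' = v" by auto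
        then show ?thesis using uv uv' \<open>(u, v) \<in> {(a, b), (b, a)}\<close> by blast
      qed
      have "\<not> separates E C UNIV (case_bool A B) S" using less.prems(3) S(2) by (meson not_less)
      then obtain Q0 where "Q0 \<subseteq> C - S" "connected_in E Q0" "hits UNIV (case_bool A B) Q0"
        using S(1) unfolding separates_def by (auto simp del: hits_case_bool)
      \<comment> \<open>The ends of the deleted edge are named so that \<open>x\<close> lies on the
        \<open>A\<close> side and \<open>y\<close> on the \<open>B\<close> side.\<close>
      from cross[OF this] obtain x y where xy: "x \<in> ?RA" "y \<in> ?RB" "(x, y) \<in> {(a, b), (b, a)}"
        by blast
      have xS: "x \<in> C - S" "y \<in> C - S" 
        using xy subsetD[OF reach_avoiding_subset] by metis+
      have xyE: "(x, y) \<in> E" using xy(3) ab symD[OF less.prems(2)] by auto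
      have EE: "E \<subseteq> E' \<union> {(x, y), (y, x)}" "E \<subseteq> E' \<union> {(y, x), (x, y)}"
        using xy(3) by (auto simp: E'_def)
      have "separates E C UNIV (case_bool A B) (insert x S)"
        unfolding separates_def
      proof (intro conjI allI impI)
        show "insert x S \<subseteq> C" using S(1) xS by (auto simp: separates_def)
        fix Q assume Q: "Q \<subseteq> C - insert x S \<and> connected_in E Q"
        show "\<not> hits UNIV (case_bool A B) Q"
        proof
          assume "hits UNIV (case_bool A B) Q"
          then obtain u v where "u \<in> Q" "v \<in> Q" "u \<in> ?RA" "v \<in> ?RB" "(u, v) \<in> {(a, b), (b, a)}"
            using cross[of Q] Q by blast
          then have "x \<in> Q" using xy disj by auto
          then show False using Q by auto
        qed
      qed
      then have "t \<le> card (insert x S)" by (rule less.prems(3))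
      then have t: "t = Suc (card S)" using S(2) finS xS(1) by simp
      have "t \<le> card Z" if "separates E' C UNIV (case_bool A (insert x S)) Z" for Z
        using separates_deleted_edge[OF less.prems(2) E'(2) EE(1) S(1) xy(2) that]
        by (rule less.prems(3))
      then obtain FA where FA: "finite FA" "card FA = t" "pairwise disjnt FA"
        "\<forall>X\<in>FA. X \<subseteq> C \<and> connected_in E' X \<and> X \<inter> A \<noteq> {} \<and> X \<inter> insert x S \<noteq> {}"
        using less.hyps[OF E'(3,1,2), of A "insert x S"] by blast
      have "t \<le> card Z" if "separates E' C UNIV (case_bool B (insert y S)) Z" for Z
        using separates_deleted_edge[OF less.prems(2) E'(2) EE(2) S(1)[unfolded separates_commute[of _ _ A]]
            xy(1) that] less.prems(3) separates_commute[of E C A B Z] by blast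
      then obtain FB where FB: "finite FB" "card FB = t" "pairwise disjnt FB"
        "\<forall>X\<in>FB. X \<subseteq> C \<and> connected_in E' X \<and> X \<inter> B \<noteq> {} \<and> X \<inter> insert y S \<noteq> {}"
        using less.hyps[OF E'(3,1,2), of B "insert y S"] by blast
      obtain gA where gA: "\<And>p. p \<in> insert x S \<Longrightarrow> p \<in> gA p \<and> gA p \<subseteq> C \<and> connected_in E' (gA p) \<and> gA p \<inter> A \<noteq> {}"
        "\<And>p q. p \<in> insert x S \<Longrightarrow> q \<in> insert x S \<Longrightarrow> p \<noteq> q \<Longrightarrow> gA p \<inter> gA q = {}"
        "\<And>p. p \<in> insert x S \<Longrightarrow> gA p - {p} \<subseteq> reach_avoiding E' (C - insert x S) A"
        by (rule linkage_by_endpoints[of E' "insert x S" FA C A])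
          (use FA E'(2) finS t xS in auto)
      obtain gB where gB: "\<And>p. p \<in> insert y S \<Longrightarrow> p \<in> gB p \<and> gB p \<subseteq> C \<and> connected_in E' (gB p) \<and> gB p \<inter> B \<noteq> {}"
        "\<And>p q. p \<in> insert y S \<Longrightarrow> q \<in> insert y S \<Longrightarrow> p \<noteq> q \<Longrightarrow> gB p \<inter> gB q = {}"
        "\<And>p. p \<in> insert y S \<Longrightarrow> gB p - {p} \<subseteq> reach_avoiding E' (C - insert y S) B"
        by (rule linkage_by_endpoints[of E' "insert y S" FB C B])
          (use FB E'(2) finS t xS in auto)
      have sides: "v \<in> ?RA \<or> v = p \<and> p \<in> S" if "p \<in> insert x S" "v \<in> gA p" for v p
        using gA(3)[OF that(1)] that xy(1) reach_avoiding_mono[of "C - insert x S" "C - S" E' A] by blast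
      have sidesB: "v \<in> ?RB \<or> v = p \<and> p \<in> S" if "p \<in> insert y S" "v \<in> gB p" for v p
        using gB(3)[OF that(1)] that xy(2) reach_avoiding_mono[of "C - insert y S" "C - S" E' B] by blast
      \<comment> \<open>Off \<open>S\<close>, pieces from \<open>A\<close> lie on the
        \<open>A\<close> side and pieces from \<open>B\<close> on the \<open>B\<close> side, so two
        of them can share only a common end point in \<open>S\<close>.\<close>
      have meet: "p = q \<and> p \<in> S" if "p \<in> insert x S" "q \<in> insert y S" "v \<in> gA p" "v \<in> gB q" for p q v
        using sides[OF that(1,3)] sidesB[OF that(2,4)] disj
          reach_avoiding_subset[of E' "C - S" A] reach_avoiding_subset[of E' "C - S" B] by blast
      \<comment> \<open>The piece ending in \<open>x\<close> is continued by the piece ending in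
        \<open>y\<close>; every other piece is continued at its own end point.\<close>
      define \<sigma> where "\<sigma> p = (if p = x then y else p)" for p
      define W where "W p = gA p \<union> gB (\<sigma> p)" for p
      have \<sigma>: "\<sigma> p \<in> insert y S" if "p \<in> insert x S" for p using that by (auto simp: \<sigma>_def)
      have \<sigma>_neq: "\<sigma> p \<noteq> \<sigma> q" if "p \<in> insert x S" "q \<in> insert x S" "p \<noteq> q" for p q
        using that xS by (auto simp: \<sigma>_def)
      have AB: "gA p \<inter> gB (\<sigma> q) = {}" if "p \<in> insert x S" "q \<in> insert x S" "p \<noteq> q" for p q
      proof (rule ccontr)
        assume "gA p \<inter> gB (\<sigma> q) \<noteq> {}"
        then obtain v where "v \<in> gA p" "v \<in> gB (\<sigma> q)" by blast
        from meet[OF that(1) \<sigma>[OF that(2)] this] have "p = \<sigma> q" "p \<in> S" by auto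
        then show False using that xS by (auto simp: \<sigma>_def split: if_splits)
      qed
      have Wdisj: "W p \<inter> W q = {}" if "p \<in> insert x S" "q \<in> insert x S" "p \<noteq> q" for p q
        using gA(2)[OF that] gB(2)[OF \<sigma>[OF that(1)] \<sigma>[OF that(2)] \<sigma>_neq[OF that]] AB[OF that]
          AB[OF that(2,1)] that(3) unfolding W_def by blast
      have W: "W p \<subseteq> C \<and> connected_in E (W p) \<and> W p \<inter> A \<noteq> {} \<and> W p \<inter> B \<noteq> {} \<and> p \<in> W p"
        if p: "p \<in> insert x S" for p
      proof -
        have cA: "connected_in E (gA p)" and cB: "connected_in E (gB (\<sigma> p))"
          using gA(1)[OF p] gB(1)[OF \<sigma>[OF p]] connected_in_mono[OF _ E'(4)] by blast+
        have "connected_in E (W p)"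
        proof (cases "p = x")
          case True
          then have "(p, \<sigma> p) \<in> E" using xyE by (simp add: \<sigma>_def)
          then show ?thesis unfolding W_def
            using connected_in_Un_edge[OF less.prems(2) cA cB] gA(1)[OF p] gB(1)[OF \<sigma>[OF p]] by blast
        next
          case False
          then have "p \<in> gA p \<inter> gB (\<sigma> p)"
            using gA(1)[OF p] gB(1)[OF \<sigma>[OF p]] by (simp add: \<sigma>_def)
          then show ?thesis unfolding W_def using connected_in_Un[OF cA cB] by blast
        qed
        then show ?thesis using gA(1)[OF p] gB(1)[OF \<sigma>[OF p]] unfolding W_def by blast
      qed
      have "inj_on W (insert x S)"
      proof (rule inj_onI, rule ccontr)
        fix p q assume pq: "p \<in> insert x S" "q \<in> insert x S" "W p = W q" "p \<noteq> q"
        then show False using Wdisj[OF pq(1,2,4)] W[OF pq(1)] by auto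
      qed
      then have "card (W ` insert x S) = t" using t finS xS by (simp add: card_image)
      moreover have "pairwise disjnt (W ` insert x S)"
      proof (rule pairwise_imageI)
        fix p q assume pq: "p \<in> insert x S" "q \<in> insert x S" "p \<noteq> q"
        show "disjnt (W p) (W q)" using Wdisj[OF pq] by (simp add: disjnt_def)
      qed
      moreover have "\<forall>X\<in>W ` insert x S. X \<subseteq> C \<and> connected_in E X \<and> X \<inter> A \<noteq> {} \<and> X \<inter> B \<noteq> {}"
        using W by blast
      ultimately show ?thesis using finS by (intro exI[of _ "W ` insert x S"]) simp
    qed
  qed
qed

section \<open>Graph encodings\<close>

lemma pair_graph_iff:
  "pair_graph G \<longleftrightarrow> finite (pverts G) \<and> parcs G \<subseteq> pverts G \<times> pverts G \<and> sym (parcs G) \<and> irrefl (parcs G)"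
proof
  assume "pair_graph G"
  then interpret pair_graph G .
  show "finite (pverts G) \<and> parcs G \<subseteq> pverts G \<times> pverts G \<and> sym (parcs G) \<and> irrefl (parcs G)"
    using pair_finite_verts pair_sym_arcs wellformed' pair_no_loops
    by (fastforce simp: symmetric_def irrefl_def)
next
  assume G: "finite (pverts G) \<and> parcs G \<subseteq> pverts G \<times> pverts G \<and> sym (parcs G) \<and> irrefl (parcs G)"
  then have "finite (parcs G)" by (auto intro: finite_subset)
  then show "pair_graph G"
    using G by unfold_locales (auto simp: symmetric_def irrefl_def)
qed

text \<open>Library connectedness is mutual reachability in the symmetric closure; the vertices
  reachable from \<open>u\<close> form a closed set.\<close>

lemma digraph_connectedI:
  assumes "connected_in (arcs_ends H) (verts H)"
  shows "Digraph_Component.connected H"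
  unfolding Digraph_Component.connected_def strongly_connected_def
proof (intro conjI ballI)
  let ?K = "with_proj (mk_symmetric H)"
  have V: "verts ?K = verts H" by (simp add: mk_symmetric_def)
  have arcs: "arcs_ends H \<subseteq> arcs_ends ?K"
    by (auto simp: mk_symmetric_def arcs_ends_conv)
  show "verts ?K \<noteq> {}" using assms V by (simp add: connected_in_def)
  fix u v assume uv: "u \<in> verts ?K" "v \<in> verts ?K"
  have "closed_in (arcs_ends H) (verts H) {w \<in> verts H. u \<rightarrow>\<^sup>*\<^bsub>?K\<^esub> w}"
    unfolding closed_in_def
  proof (intro conjI ballI impI)
    fix x y assume "x \<in> {w \<in> verts H. u \<rightarrow>\<^sup>*\<^bsub>?K\<^esub> w}" "y \<in> verts H" "(x, y) \<in> arcs_ends H"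
    then show "y \<in> {w \<in> verts H. u \<rightarrow>\<^sup>*\<^bsub>?K\<^esub> w}"
      using arcs V unfolding reachable_def by (auto intro: rtrancl_on_into_rtrancl_on)
  qed auto
  moreover have "u \<in> {w \<in> verts H. u \<rightarrow>\<^sup>*\<^bsub>?K\<^esub> w}"
    using uv V by (simp add: reachable_def)
  ultimately have "{w \<in> verts H. u \<rightarrow>\<^sup>*\<^bsub>?K\<^esub> w} = verts H"
    using connected_in_closed_eq[OF assms] by blast
  then show "u \<rightarrow>\<^sup>*\<^bsub>?K\<^esub> v" using uv V by blast
qed

lemma digraph_connected_inducedI:
  assumes "connected_in (parcs T) B"
  shows "Digraph_Component.connected (with_proj T \<restriction> B)"
proof (rule digraph_connectedI)
  have "arcs_ends (with_proj T \<restriction> B) = parcs T \<inter> B \<times> B"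
    by (auto simp: arcs_ends_conv induce_subgraph_def image_iff)
  then show "connected_in (arcs_ends (with_proj T \<restriction> B)) (verts (with_proj T \<restriction> B))"
    using assms by (simp add: connected_in_restrict)
qed

lemma subgraph_with_projI:
  assumes "pverts S \<subseteq> pverts K" "parcs S \<subseteq> parcs K"
    and "parcs S \<subseteq> pverts S \<times> pverts S" "parcs K \<subseteq> pverts K \<times> pverts K"
  shows "subgraph (with_proj S) (with_proj K)"
  using assms unfolding subgraph_def compatible_def by (auto intro!: wf_digraph.intro)

lemma digraph_iso_image:
  assumes "inj_on g (pverts X)" "parcs X \<subseteq> pverts X \<times> pverts X"
    and "Y = \<lparr>pverts = g ` pverts X, parcs = map_prod g g ` parcs X\<rparr>"
  shows "digraph_iso (with_proj X) (with_proj Y)"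
proof -
  let ?f = "\<lparr>iso_verts = g, iso_arcs = map_prod g g, iso_head = snd, iso_tail = fst\<rparr>"
  have "inj_on (map_prod g g) (parcs X)"
    using map_prod_inj_on[OF assms(1,1)] assms(2) by (rule inj_on_subset)
  moreover have "wf_digraph (with_proj X)" using assms(2) by (auto intro!: wf_digraph.intro)
  ultimately have "pre_digraph.digraph_isomorphism (with_proj X) ?f"
    using assms(1) by (simp add: pre_digraph.digraph_isomorphism_def)
  moreover have "with_proj Y = app_iso ?f (with_proj X)"
    by (simp add: app_iso_def assms(3) with_proj_def)
  ultimately show ?thesis unfolding digraph_iso_def by blast
qed

section \<open>Minors from connected branch sets\<close>

text \<open>Contractions of single edges have this form, and it is closed under composition, so a
  whole sequence of contractions is tracked by one function.\<close>

definition quotient_graph :: "('a \<Rightarrow> 'b) \<Rightarrow> 'a pair_pre_digraph \<Rightarrow> 'b pair_pre_digraph" where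
  "quotient_graph f G = \<lparr>pverts = f ` pverts G,
     parcs = {(f x, f y) | x y. (x, y) \<in> parcs G \<and> f x \<noteq> f y}\<rparr>"

lemma contract_edge_eq_quotient_graph:
  "contract_edge G u v = quotient_graph (\<lambda>w. if w = v then u else w) G"
  by (simp add: contract_edge_def quotient_graph_def Let_def)

lemma pair_graph_quotient_graph: "pair_graph G \<Longrightarrow> pair_graph (quotient_graph f G)"
  unfolding pair_graph_iff quotient_graph_def sym_def irrefl_def by fastforce

lemma quotient_graph_comp: "quotient_graph f (quotient_graph h G) = quotient_graph (f \<circ> h) G"
proof -
  have "{(f x, f y) | x y. (x, y) \<in> {(h u, h v) | u v. (u, v) \<in> parcs G \<and> h u \<noteq> h v} \<and> f x \<noteq> f y}
    = {((f \<circ> h) u, (f \<circ> h) v) | u v. (u, v) \<in> parcs G \<and> (f \<circ> h) u \<noteq> (f \<circ> h) v}" (is "?L = ?R")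
  proof
    show "?L \<subseteq> ?R" by auto
    show "?R \<subseteq> ?L"
    proof
      fix e assume "e \<in> ?R"
      then obtain u v where uv: "e = (f (h u), f (h v))" "(u, v) \<in> parcs G" "f (h u) \<noteq> f (h v)" by auto
      then have "h u \<noteq> h v" by auto
      then have "(h u, h v) \<in> {(h u, h v) | u v. (u, v) \<in> parcs G \<and> h u \<noteq> h v}" using uv(2) by blast
      then show "e \<in> ?L" using uv(1,3) by blast
    qed
  qed
  then show ?thesis by (simp add: quotient_graph_def image_comp)
qed

lemma digraph_iso_quotient_graph_inj:
  assumes "pair_graph G" "inj_on f (pverts G)"
  shows "digraph_iso (with_proj (quotient_graph f G)) (with_proj G)"
proof (rule digraph_iso_image)
  let ?g = "inv_into (pverts G) f"
  have E: "parcs G \<subseteq> pverts G \<times> pverts G" "irrefl (parcs G)"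
    using assms(1) by (auto simp: pair_graph_iff)
  have inv: "?g (f x) = x" if "x \<in> pverts G" for x using assms(2) that by (rule inv_into_f_f)
  show "inj_on ?g (pverts (quotient_graph f G))"
    by (simp add: quotient_graph_def inj_on_inv_into)
  show "parcs (quotient_graph f G) \<subseteq> pverts (quotient_graph f G) \<times> pverts (quotient_graph f G)"
    using E by (auto simp: quotient_graph_def)
  have "parcs (quotient_graph f G) = map_prod f f ` parcs G"
    using E assms(2) unfolding quotient_graph_def irrefl_def
    by (auto simp: image_iff) (metis SigmaD1 SigmaD2 inj_onD subsetD)
  moreover have "map_prod ?g ?g ` map_prod f f ` parcs G = parcs G"
  proof -
    have "(map_prod ?g ?g \<circ> map_prod f f) e = e" if "e \<in> parcs G" for e
      using that E(1) inv by (cases e) auto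
    then show ?thesis unfolding image_comp by simp
  qed
  moreover have "?g ` f ` pverts G = pverts G" using assms(2) by (simp add: inv_into_image_cancel)
  ultimately show "G = \<lparr>pverts = ?g ` pverts (quotient_graph f G),
      parcs = map_prod ?g ?g ` parcs (quotient_graph f G)\<rparr>"
    by (simp add: quotient_graph_def)
qed

text \<open>A fibre with two vertices contains an arc by connectedness; contracting it changes
  neither the quotient nor the connectedness of the fibres. The source \<open>G\<close> stays fixed
  while \<open>S\<close> shrinks, because \<open>contracts_to\<close> appends its steps at the
  end.\<close>

lemma contracts_to_quotient_graph:
  assumes "pair_graph S" "contracts_to G S"
    and "\<And>v. v \<in> pverts S \<Longrightarrow> connected_in (parcs S) {w \<in> pverts S. f w = f v}"
  shows "\<exists>Y. contracts_to G Y \<and> digraph_iso (with_proj (quotient_graph f S)) (with_proj Y)"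
  using assms
proof (induction "card (pverts S)" arbitrary: S rule: less_induct)
  case less
  show ?case
  proof (cases "inj_on f (pverts S)")
    case True
    then show ?thesis using less.prems(1,2) digraph_iso_quotient_graph_inj by blast
  next
    case False
    then obtain x y where xy: "x \<in> pverts S" "y \<in> pverts S" "x \<noteq> y" "f x = f y"
      by (auto simp: inj_on_def)
    obtain u v where uv: "u \<in> {w \<in> pverts S. f w = f x}" "u \<in> {x}"
        "v \<in> {w \<in> pverts S. f w = f x}" "v \<notin> {x}" "(u, v) \<in> parcs S"
      using connected_in_crossing[OF less.prems(3)[OF xy(1)], of x "{x}" y] xy by auto
    let ?h = "\<lambda>w. if w = v then u else w"
    let ?S = "contract_edge S u v"
    have fh: "f (?h w) = f w" for w using uv by auto
    have S: "finite (pverts S)" using less.prems(1) by (simp add: pair_graph_iff)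
    have V: "pverts ?S = pverts S - {v}"
      using uv by (auto simp: contract_edge_eq_quotient_graph quotient_graph_def)
    have "card (pverts ?S) < card (pverts S)"
      unfolding V using S uv(3) by (intro psubset_card_mono) auto
    moreover have "pair_graph ?S"
      using less.prems(1) by (simp add: contract_edge_eq_quotient_graph pair_graph_quotient_graph)
    moreover have "contracts_to G ?S" using less.prems(2) uv(5) by (rule contracts_to.step)
    moreover have "connected_in (parcs ?S) {w \<in> pverts ?S. f w = f z}" if z: "z \<in> pverts ?S" for z
    proof -
      have "z \<in> pverts S" using z V by auto
      have "connected_in (parcs ?S) (?h ` {w \<in> pverts S. f w = f z})"
      proof (rule connected_in_image[OF less.prems(3)[OF \<open>z \<in> pverts S\<close>]])
        fix a b assume "(a, b) \<in> parcs S"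
        then show "?h a = ?h b \<or> (?h a, ?h b) \<in> parcs ?S"
          unfolding contract_edge_eq_quotient_graph quotient_graph_def by auto
      qed
      moreover have "?h ` {w \<in> pverts S. f w = f z} = {w \<in> pverts ?S. f w = f z}"
        unfolding V using uv by auto
      ultimately show ?thesis by simp
    qed
    ultimately obtain Y where "contracts_to G Y"
        "digraph_iso (with_proj (quotient_graph f ?S)) (with_proj Y)"
      using less.hyps[of ?S] by blast
    moreover have "quotient_graph f ?S = quotient_graph f S"
      unfolding contract_edge_eq_quotient_graph quotient_graph_comp using fh by (simp add: comp_def)
    ultimately show ?thesis by auto
  qed
qed

lemma minor_of_branch_sets:
  assumes G: "pair_graph G" and "W \<subseteq> pverts G"
    and "\<And>v. v \<in> W \<Longrightarrow> connected_in (parcs G) {w \<in> W. f w = f v}"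
  shows "minor (quotient_graph f \<lparr>pverts = W, parcs = parcs G \<inter> W \<times> W\<rparr>) G"
proof -
  let ?S = "\<lparr>pverts = W, parcs = parcs G \<inter> W \<times> W\<rparr>"
  have S: "pair_graph ?S"
    using G assms(2) by (auto simp: pair_graph_iff sym_def irrefl_def intro: finite_subset)
  have "connected_in (parcs ?S) {w \<in> pverts ?S. f w = f v}" if "v \<in> pverts ?S" for v
  proof -
    let ?F = "{w \<in> W. f w = f v}"
    have "connected_in (parcs G \<inter> ?F \<times> ?F) ?F" using assms(3) that by (simp add: connected_in_restrict)
    then show ?thesis using connected_in_mono[of "parcs G \<inter> ?F \<times> ?F" ?F "parcs ?S"] by auto
  qed
  then obtain Y where "contracts_to ?S Y" "digraph_iso (with_proj (quotient_graph f ?S)) (with_proj Y)"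
    using contracts_to_quotient_graph[OF S contracts_to.refl] by blast
  moreover have "subgraph (with_proj ?S) (with_proj G)"
    using G assms(2) by (intro subgraph_with_projI) (auto simp: pair_graph_iff)
  ultimately show ?thesis using S unfolding minor_def by blast
qed

text \<open>Remaining vertices are absorbed one by one along arcs leaving the union of the sets.
  Covering all of \<open>C\<close> matters: the quotient of the connected set \<open>C\<close> is
  then connected, as the second side of a member of \<open>J_class\<close> has to be.\<close>

lemma extend_to_connected_partition:
  assumes "sym E" "finite C" "connected_in E C" "I \<noteq> {}"
    and "\<And>i. i \<in> I \<Longrightarrow> Y i \<subseteq> C \<and> connected_in E (Y i)"
    and "\<And>i j. i \<in> I \<Longrightarrow> j \<in> I \<Longrightarrow> i \<noteq> j \<Longrightarrow> Y i \<inter> Y j = {}"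
  shows "\<exists>g. g ` C \<subseteq> I \<and> (\<forall>i\<in>I. Y i \<subseteq> {v \<in> C. g v = i} \<and> connected_in E {v \<in> C. g v = i})"
  using assms(5,6)
proof (induction "card (C - (\<Union>i\<in>I. Y i))" arbitrary: Y rule: less_induct)
  case less
  let ?U = "\<Union>i\<in>I. Y i"
  show ?case
  proof (cases "C \<subseteq> ?U")
    case True
    then have "\<forall>v\<in>C. \<exists>i. i \<in> I \<and> v \<in> Y i" by blast
    then obtain g where g: "\<And>v. v \<in> C \<Longrightarrow> g v \<in> I \<and> v \<in> Y (g v)" by metis
    have "{v \<in> C. g v = i} = Y i" if "i \<in> I" for i
    proof -
      have "g v = i" if "v \<in> Y i" for v
        using less.prems that \<open>i \<in> I\<close> g[of v] by (metis disjoint_iff subsetD)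
      then show ?thesis using g less.prems(1)[OF that] by blast
    qed
    then show ?thesis using g less.prems(1) by (intro exI[of _ g]) auto
  next
    case False
    then obtain y where y: "y \<in> C" "y \<notin> ?U" by blast
    obtain i where i: "i \<in> I" using assms(4) by blast
    obtain x where x: "x \<in> Y i" using less.prems(1)[OF i] connected_in_nonempty by blast
    obtain u v where uv: "u \<in> C" "u \<in> ?U" "v \<in> C" "v \<notin> ?U" "(u, v) \<in> E"
      by (rule connected_in_crossing[OF assms(3) _ _ y]) (use x i less.prems(1) in blast)+
    then obtain k where k: "k \<in> I" "u \<in> Y k" by blast
    define Y' where "Y' = Y(k := insert v (Y k))"
    have conn: "connected_in E (insert v (Y k))"
      using connected_in_insert[OF assms(1) _ k(2) uv(5)] less.prems(1)[OF k(1)] by blast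
    have "C - (\<Union>i\<in>I. Y' i) \<subset> C - ?U"
      using uv(3,4) k(1) by (auto simp: Y'_def)
    then have "card (C - (\<Union>i\<in>I. Y' i)) < card (C - ?U)"
      using assms(2) by (intro psubset_card_mono) auto
    moreover have "Y' i \<subseteq> C \<and> connected_in E (Y' i)" if "i \<in> I" for i
      using that less.prems(1) conn uv(3) k by (auto simp: Y'_def)
    moreover have "Y' i \<inter> Y' j = {}" if "i \<in> I" "j \<in> I" "i \<noteq> j" for i j
      using less.prems(2)[OF that] uv(4) that by (auto simp: Y'_def)
    ultimately obtain g where g: "g ` C \<subseteq> I"
        "\<forall>i\<in>I. Y' i \<subseteq> {v \<in> C. g v = i} \<and> connected_in E {v \<in> C. g v = i}"
      using less.hyps[of Y'] by blast
    have "Y i \<subseteq> Y' i" for i by (auto simp: Y'_def)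
    then show ?thesis using g by (intro exI[of _ g]) blast
  qed
qed

text \<open>Labels below \<open>s\<close> name the branch sets of the clique; labels from
  \<open>s\<close> to \<open>s + t - 1\<close> name the members of \<open>F\<close>, each grown to a
  class of a partition of \<open>C\<close>. Growing preserves the required adjacencies, and the
  second side inherits its connectedness from \<open>C\<close>.\<close>

lemma J_minor_of_models:
  fixes B :: "'i \<Rightarrow> 'a set"
  assumes G: "pair_graph G" and K: "finite K" "card K = s" and t: "t \<ge> 1"
    and C: "C \<subseteq> pverts G" "connected_in (parcs G) C"
    and B: "\<And>i. i \<in> K \<Longrightarrow> B i \<subseteq> pverts G - C \<and> connected_in (parcs G) (B i)"
    and Bdisj: "\<And>i j. i \<in> K \<Longrightarrow> j \<in> K \<Longrightarrow> i \<noteq> j \<Longrightarrow> B i \<inter> B j = {}"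
    and Badj: "\<And>i j. i \<in> K \<Longrightarrow> j \<in> K \<Longrightarrow> i \<noteq> j \<Longrightarrow> \<exists>u\<in>B i. \<exists>v\<in>B j. (u, v) \<in> parcs G"
    and F: "finite F" "card F = t" "pairwise disjnt F"
    and FX: "\<And>X. X \<in> F \<Longrightarrow> X \<subseteq> C \<and> connected_in (parcs G) X"
    and Fadj: "\<And>X i. X \<in> F \<Longrightarrow> i \<in> K \<Longrightarrow> \<exists>u\<in>B i. \<exists>v\<in>X. (u, v) \<in> parcs G"
  shows "\<not> J_minor_free s t G"
proof -
  let ?E = "parcs G"
  have sym: "sym ?E" and finV: "finite (pverts G)" using G by (auto simp: pair_graph_iff)
  obtain a where a: "bij_betw a K {..<s}"
    using ex_bij_betw_finite_nat[OF K(1)] K(2) by (auto simp: atLeast0LessThan)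
  obtain b where b: "bij_betw b {s..<s + t} F"
    using F(1,2) by (metis add_diff_cancel_left' bij_betw_iff_card card_atLeastLessThan finite_atLeastLessThan)
  have bF: "b j \<in> F" if "j \<in> {s..<s + t}" for j using b that bij_betwE by blast
  have "\<exists>g. g ` C \<subseteq> {s..<s + t} \<and>
    (\<forall>j\<in>{s..<s + t}. b j \<subseteq> {v \<in> C. g v = j} \<and> connected_in ?E {v \<in> C. g v = j})"
  proof (rule extend_to_connected_partition[OF sym _ C(2)])
    show "finite C" using C(1) finV finite_subset by blast
    show "{s..<s + t} \<noteq> {}" using t by auto
    show "b i \<subseteq> C \<and> connected_in ?E (b i)" if "i \<in> {s..<s + t}" for i using bF FX that by blast
    fix i j assume ij: "i \<in> {s..<s + t}" "j \<in> {s..<s + t}" "i \<noteq> j"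
    then have "b i \<noteq> b j" using b by (metis bij_betw_imp_inj_on inj_onD)
    then show "b i \<inter> b j = {}" using F(3) bF ij by (simp add: pairwise_def disjnt_def)
  qed
  then obtain g where g0: "g ` C \<subseteq> {s..<s + t} \<and>
    (\<forall>j\<in>{s..<s + t}. b j \<subseteq> {v \<in> C. g v = j} \<and> connected_in ?E {v \<in> C. g v = j})" ..
  note g = conjunct1[OF g0] bspec[OF conjunct2[OF g0]]
  define W where "W = C \<union> (\<Union>i\<in>K. B i)"
  define f where "f v = (if v \<in> C then g v else a (THE i. i \<in> K \<and> v \<in> B i))" for v
  have fC: "f v = g v" if "v \<in> C" for v using that by (simp add: f_def)
  have fB: "f v = a i" if "i \<in> K" "v \<in> B i" for v i
  proof -
    have "(THE i. i \<in> K \<and> v \<in> B i) = i" using that Bdisj by (intro the_equality) blast+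
    moreover have "v \<notin> C" using B that by blast
    ultimately show ?thesis by (simp add: f_def)
  qed
  have aK: "a i < s" if "i \<in> K" for i using a that bij_betwE by blast
  have gC: "g v \<in> {s..<s + t}" if "v \<in> C" for v using g(1) that by blast
  have fibC: "{w \<in> W. f w = j} = {v \<in> C. g v = j}" if "j \<in> {s..<s + t}" for j
    using that fC fB aK by (fastforce simp: W_def)
  have fibB: "{w \<in> W. f w = a i} = B i" if "i \<in> K" for i
  proof
    show "{w \<in> W. f w = a i} \<subseteq> B i"
    proof
      fix w assume w: "w \<in> {w \<in> W. f w = a i}"
      have "w \<notin> C" using w fC[of w] gC[of w] aK[OF that] by auto
      then obtain j where j: "j \<in> K" "w \<in> B j" using w by (auto simp: W_def)
      then have "a j = a i" using w fB by auto
      then have "j = i" using a j(1) that by (metis bij_betw_imp_inj_on inj_onD)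
      then show "w \<in> B i" using j(2) by simp
    qed
  qed (use that fB in \<open>auto simp: W_def\<close>)
  let ?S = "\<lparr>pverts = W, parcs = parcs G \<inter> W \<times> W\<rparr>"
  let ?X = "quotient_graph f ?S"
  have WG: "W \<subseteq> pverts G" using C(1) B by (auto simp: W_def)
  have "minor ?X G"
  proof (rule minor_of_branch_sets[OF G WG])
    fix v assume "v \<in> W"
    then consider "v \<in> C" | i where "i \<in> K" "v \<in> B i" by (auto simp: W_def)
    then show "connected_in ?E {w \<in> W. f w = f v}"
    proof cases
      case 1
      then show ?thesis using fC fibC gC g(2) by simp
    next
      case 2
      then show ?thesis using fB fibB B by simp
    qed
  qed
  moreover have "?X \<in> J_class s t"
  proof -
    have pg: "pair_graph ?X"
      using G WG by (intro pair_graph_quotient_graph)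
        (auto simp: pair_graph_iff sym_def irrefl_def intro: finite_subset)
    have imC: "f ` C = {s..<s + t}"
    proof
      show "f ` C \<subseteq> {s..<s + t}" using fC gC by auto
      show "{s..<s + t} \<subseteq> f ` C"
      proof
        fix j assume j: "j \<in> {s..<s + t}"
        then obtain v where "v \<in> C" "g v = j" using connected_in_nonempty g(2) by blast
        then show "j \<in> f ` C" using fC by (metis imageI)
      qed
    qed
    have imB: "f ` (\<Union>i\<in>K. B i) = {..<s}"
    proof
      show "f ` (\<Union>i\<in>K. B i) \<subseteq> {..<s}" using fB aK by auto
      show "{..<s} \<subseteq> f ` (\<Union>i\<in>K. B i)"
      proof
        fix j assume "j \<in> {..<s}"
        then obtain i where i: "i \<in> K" "j = a i" using a by (auto simp: bij_betw_def)
        then obtain v where "v \<in> B i" using B connected_in_nonempty by blast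
        then show "j \<in> f ` (\<Union>i\<in>K. B i)" using i fB by force
      qed
    qed
    have arc: "(f u, f v) \<in> parcs ?X" if "u \<in> W" "v \<in> W" "(u, v) \<in> ?E" "f u \<noteq> f v" for u v
      using that by (auto simp: quotient_graph_def)
    have "pverts ?X = {..<s} \<union> {s..<s + t}"
      using imC imB by (auto simp: quotient_graph_def W_def image_Un)
    moreover have "(x, y) \<in> parcs ?X" if xy: "x \<in> {..<s}" "y \<in> {..<s}" "x \<noteq> y" for x y
    proof -
      obtain i j where ij: "i \<in> K" "x = a i" "j \<in> K" "y = a j"
        using xy(1,2) unfolding bij_betw_imp_surj_on[OF a, symmetric] by blast
      then obtain u v where "u \<in> B i" "v \<in> B j" "(u, v) \<in> ?E" using Badj[of i j] xy(3) by blast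
      then show ?thesis using arc[of u v] fB ij xy(3) by (auto simp: W_def)
    qed
    moreover have "(x, y) \<in> parcs ?X" if xy: "x \<in> {..<s}" "y \<in> {s..<s + t}" for x y
    proof -
      obtain i where i: "i \<in> K" "x = a i"
        using xy(1) unfolding bij_betw_imp_surj_on[OF a, symmetric] by blast
      obtain u v where uv: "u \<in> B i" "v \<in> b y" "(u, v) \<in> ?E" using Fadj[OF bF[OF xy(2)] i(1)] by blast
      then have "v \<in> C" "g v = y" using g(2)[OF xy(2)] by auto
      then show ?thesis using arc[of u v] fB[OF i(1) uv(1)] fC i uv xy by (auto simp: W_def)
    qed
    moreover have "Digraph_Component.connected (with_proj ?X \<restriction> {s..<s + t})"
    proof (rule digraph_connected_inducedI)
      have "connected_in (parcs ?X) (f ` C)"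
        by (rule connected_in_image[OF C(2)]) (use arc in \<open>auto simp: W_def\<close>)
      then show "connected_in (parcs ?X) {s..<s + t}" by (simp add: imC)
    qed
    ultimately show ?thesis using pg unfolding J_class_def
      by (intro CollectI conjI exI[of _ "{..<s}"] exI[of _ "{s..<s + t}"]) auto
  qed
  ultimately show ?thesis unfolding J_minor_free_def by blast
qed

section \<open>Tree-decompositions from elimination orders\<close>

definition parent_graph :: "nat \<Rightarrow> (nat \<Rightarrow> nat) \<Rightarrow> nat pair_pre_digraph" where
  "parent_graph N p = \<lparr>pverts = {..<N},
     parcs = {(i, j). i < N \<and> j < N \<and> (0 < j \<and> i = p j \<or> 0 < i \<and> j = p i)}\<rparr>"

text \<open>The least element of a nonempty closed \<open>R\<close> must be \<open>r\<close>, since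
  otherwise its parent would be a smaller element of \<open>R\<close>. From \<open>r\<close>,
  induction recovers all of \<open>S\<close>, every vertex following its parent.\<close>

lemma connected_in_parent_graph:
  assumes p: "\<And>i. 0 < i \<Longrightarrow> i < N \<Longrightarrow> p i < i"
    and S: "S \<subseteq> {..<N}" "r \<in> S" "\<And>x. x \<in> S \<Longrightarrow> x \<noteq> r \<Longrightarrow> 0 < x \<and> p x \<in> S"
  shows "connected_in (parcs (parent_graph N p)) S"
  unfolding connected_in_def
proof (intro conjI allI impI)
  let ?E = "parcs (parent_graph N p)"
  fix R assume R: "closed_in ?E S R \<and> R \<noteq> {}"
  then have RS: "R \<subseteq> S" by (simp add: closed_in_def)
  have E: "(x, p x) \<in> ?E" "(p x, x) \<in> ?E" if "x \<in> S" "x \<noteq> r" for x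
    using S that by (auto simp: parent_graph_def)
  have "finite R" using finite_subset[OF RS finite_subset[OF S(1)]] by simp
  then have min: "Min R \<in> R" using R by simp
  have "Min R = r"
  proof (rule ccontr)
    assume "Min R \<noteq> r"
    then have *: "0 < Min R" "p (Min R) \<in> S" "Min R \<in> S" using S(3) min RS by auto
    then have "p (Min R) \<in> R" using R E(1)[OF _ \<open>Min R \<noteq> r\<close>] min by (auto simp: closed_in_def)
    moreover have "p (Min R) < Min R" using p * S(1) by blast
    ultimately show False using \<open>finite R\<close> by (meson Min_le not_less)
  qed
  have "x \<in> S \<Longrightarrow> x \<in> R" for x
  proof (induction x rule: less_induct)
    case (less x)
    show ?case
    proof (cases "x = r")
      case True
      then show ?thesis using min \<open>Min R = r\<close> by simp
    next
      case False
      then have "0 < x" "p x \<in> S" using S(3) less.prems by auto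
      then have "p x \<in> R" using less.IH p less.prems S(1) by blast
      then show ?thesis using R E(2)[OF less.prems False] less.prems by (auto simp: closed_in_def)
    qed
  qed
  then show "R = S" using RS by blast
qed (use S in auto)

lemma pcas_nth:
  "pcas u p v \<Longrightarrow> (\<forall>i. Suc i < length p \<longrightarrow> snd (p ! i) = fst (p ! Suc i)) \<and>
     (p \<noteq> [] \<longrightarrow> fst (p ! 0) = u \<and> snd (p ! (length p - 1)) = v)"
proof (induction p arbitrary: u)
  case (Cons e es)
  then have IH: "\<forall>i. Suc i < length es \<longrightarrow> snd (es ! i) = fst (es ! Suc i)"
    "es \<noteq> [] \<longrightarrow> fst (es ! 0) = snd e \<and> snd (es ! (length es - 1)) = v" by auto
  show ?case
  proof (intro conjI allI impI)
    fix i assume "Suc i < length (e # es)"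
    then show "snd ((e # es) ! i) = fst ((e # es) ! Suc i)" using IH by (cases i) auto
  next
    show "snd ((e # es) ! (length (e # es) - 1)) = v"
      using IH(2) Cons.prems by (cases es) auto
  qed (use Cons.prems in auto)
qed simp

lemma pawalk_verts_tl: "tl (pawalk_verts u p) = map snd p" if "pcas u p v"
  using that
proof (induction p arbitrary: u)
  case (Cons e es)
  then show ?case by (cases es) auto
qed simp

text \<open>On a cycle, both neighbours of the largest vertex are smaller, and the only smaller
  neighbour of a vertex is its parent. The two neighbours therefore coincide, which length at least
  3 excludes.\<close>

lemma undirected_tree_parent_graph:
  assumes N: "N \<ge> 1" and p: "\<And>i. 0 < i \<Longrightarrow> i < N \<Longrightarrow> p i < i"
  shows "undirected_tree (parent_graph N p)"
proof -
  let ?T = "parent_graph N p"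
  have "finite (pverts ?T)" "parcs ?T \<subseteq> pverts ?T \<times> pverts ?T" "sym (parcs ?T)" "irrefl (parcs ?T)"
    using p by (auto simp: parent_graph_def sym_def irrefl_def) (metis less_irrefl)
  then have "pair_graph ?T" by (simp add: pair_graph_iff)
  moreover have "Digraph_Component.connected (with_proj ?T)"
  proof (rule digraph_connectedI)
    have "connected_in (parcs ?T) {..<N}"
    proof (rule connected_in_parent_graph[OF p])
      show "0 \<in> {..<N}" using N by simp
      show "0 < x \<and> p x \<in> {..<N}" if "x \<in> {..<N}" "x \<noteq> 0" for x using that p[of x] by simp
    qed auto
    then show "connected_in (arcs_ends (with_proj ?T)) (verts (with_proj ?T))"
      by (simp add: parent_graph_def)
  qed
  moreover have False if cyc: "pre_digraph.cycle (with_proj ?T) c" and len: "length c \<ge> 3" for c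
  proof -
    let ?L = "length c"
    obtain u where u: "set c \<subseteq> parcs ?T" "pcas u c u" "distinct (tl (pawalk_verts u c))"
      using cyc by (auto simp: pre_digraph.cycle_def pre_digraph.awalk_def cas_with_proj_eq
          awalk_verts_with_proj_eq)
    have dist: "distinct (map snd c)" using u(3) pawalk_verts_tl[OF u(2)] by simp
    have next_arc: "snd (c ! i) = fst (c ! (Suc i mod ?L))" if "i < ?L" for i
    proof (cases "Suc i < ?L")
      case True
      then show ?thesis using pcas_nth[OF u(2)] by simp
    next
      case False
      then have "Suc i = ?L" using that by simp
      then have "i = ?L - 1" "Suc i mod ?L = 0" by (simp, metis mod_self)
      then show ?thesis using pcas_nth[OF u(2)] len by auto
    qed
    let ?M = "Max (snd ` set c)"
    have ne: "snd ` set c \<noteq> {}" using len by auto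
    have "?M \<in> snd ` set c" using ne by (intro Max_in) auto
    then obtain i where i: "i < ?L" "snd (c ! i) = ?M" by (auto simp: in_set_conv_nth)
    \<comment> \<open>Cyclically, arc \<open>j\<close> precedes arc \<open>i\<close> and arc
      \<open>k\<close> follows it; arc \<open>i\<close> ends in the maximum.\<close>
    define j where "j = (if i = 0 then ?L - 1 else i - 1)"
    define k where "k = Suc i mod ?L"
    have j: "j < ?L" "Suc j mod ?L = i" using i len by (auto simp: j_def)
    have k: "k < ?L" unfolding k_def using i(1) by (intro mod_less_divisor) linarith
    have below: "x = p ?M" if "(x, ?M) \<in> parcs ?T" "x \<in> snd ` set c" for x
    proof -
      have "x \<le> ?M" using that(2) by (intro Max_ge) auto
      then show ?thesis using that(1) p[of x] by (auto simp: parent_graph_def)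
    qed
    have "snd (c ! j) = fst (c ! i)" using next_arc[OF j(1)] j(2) by simp
    moreover have "c ! i \<in> parcs ?T" using u(1) i(1) by auto
    ultimately have "(snd (c ! j), ?M) \<in> parcs ?T" using i(2) by (metis prod.collapse)
    then have 1: "snd (c ! j) = p ?M" using j(1) by (intro below) auto
    have "fst (c ! k) = ?M" using next_arc[OF i(1)] i(2) by (simp add: k_def)
    moreover have "c ! k \<in> parcs ?T" using u(1) k by auto
    ultimately have "(?M, snd (c ! k)) \<in> parcs ?T" by (metis prod.collapse)
    then have "(snd (c ! k), ?M) \<in> parcs ?T" using \<open>sym (parcs ?T)\<close> by (rule symD[rotated])
    then have 2: "snd (c ! k) = p ?M" using k by (intro below) auto
    have "j = k" using dist 1 2 j(1) k by (metis length_map nth_eq_iff_index_eq nth_map)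
    then show False using i(1) len by (auto simp: j_def k_def mod_Suc split: if_splits)
  qed
  ultimately show ?thesis unfolding undirected_tree_def by blast
qed

text \<open>\<open>P i\<close> holds the earlier neighbours of \<open>i\<close>. Iterating the
  condition on the maximum shows that \<open>P i\<close> is a clique, so the reversed numbering is a
  perfect elimination order; the one-step form is what the tree-decomposition uses.\<close>

definition elimination_order :: "nat \<Rightarrow> nat \<Rightarrow> (nat \<Rightarrow> nat set) \<Rightarrow> bool" where
  "elimination_order s N P \<longleftrightarrow> (\<forall>i<N. P i \<subseteq> {..<i} \<and> card (P i) \<le> s \<and>
     (P i \<noteq> {} \<longrightarrow> P i - {Max (P i)} \<subseteq> P (Max (P i))))"

definition elimination_graph :: "nat \<Rightarrow> (nat \<Rightarrow> nat set) \<Rightarrow> nat pair_pre_digraph" where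
  "elimination_graph N P = \<lparr>pverts = {..<N}, parcs = {(i, j). i < N \<and> j < N \<and> (i \<in> P j \<or> j \<in> P i)}\<rparr>"

lemma pair_graph_elimination_graph:
  "elimination_order s N P \<Longrightarrow> pair_graph (elimination_graph N P)"
  unfolding pair_graph_iff elimination_graph_def elimination_order_def sym_def irrefl_def by auto

lemma treewidth_le_td_width:
  fixes T :: "nat pair_pre_digraph"
  assumes "tree_decomposition G T \<beta>"
  shows "treewidth G \<le> td_width T \<beta>"
  unfolding treewidth_def
proof (rule cInf_lower)
  show "bdd_below {td_width T \<beta> | (T :: nat pair_pre_digraph) \<beta>. tree_decomposition G T \<beta>}"
    by (rule bdd_belowI[of _ "-1"]) (auto simp: td_width_def)
qed (use assms in blast)

text \<open>Bag \<open>i\<close> is \<open>insert i (P i)\<close>. If \<open>P i\<close> is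
  nonempty, it hangs below the bag of \<open>Max (P i)\<close>, which contains all of
  \<open>P i\<close> by the elimination condition; so the nodes whose bags contain \<open>v\<close>
  form a subtree with top \<open>v\<close>.\<close>

lemma treewidth_elimination_graph:
  assumes P: "elimination_order s N P" and N: "N \<ge> 1"
  shows "treewidth (elimination_graph N P) \<le> int s"
proof -
  let ?H = "elimination_graph N P"
  \<comment> \<open>A vertex without earlier neighbours is hung below node 0, which turns the forest
    into one tree.\<close>
  define p where "p i = (if P i = {} then 0 else Max (P i))" for i
  let ?T = "parent_graph N p"
  let ?\<beta> = "\<lambda>i. insert i (P i)"
  have Pi: "P i \<subseteq> {..<i}" "card (P i) \<le> s" "P i \<noteq> {} \<Longrightarrow> P i - {Max (P i)} \<subseteq> P (Max (P i))"
    if "i < N" for i using P that by (auto simp: elimination_order_def)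
  have fin: "finite (P i)" if "i < N" for i using finite_subset[OF Pi(1)[OF that]] by simp
  have Max: "Max (P i) \<in> P i" if "i < N" "P i \<noteq> {}" for i using fin that by simp
  have p: "p i < i" if "0 < i" "i < N" for i
    using Max[OF that(2)] Pi(1)[OF that(2)] that(1) by (auto simp: p_def)
  have "tree_decomposition ?H ?T ?\<beta>"
    unfolding tree_decomposition_def
  proof (intro conjI)
    show "undirected_tree ?T" using undirected_tree_parent_graph[OF N p] by blast
    show "\<forall>x\<in>pverts ?T. ?\<beta> x \<subseteq> pverts ?H"
      using Pi(1) by (fastforce simp: parent_graph_def elimination_graph_def)
    show "\<forall>(u, v)\<in>parcs ?H. \<exists>x\<in>pverts ?T. u \<in> ?\<beta> x \<and> v \<in> ?\<beta> x"
      by (auto simp: parent_graph_def elimination_graph_def)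
    show "\<forall>v\<in>pverts ?H. Digraph_Component.connected (with_proj ?T \<restriction> {x \<in> pverts ?T. v \<in> ?\<beta> x})"
    proof
      fix v assume v: "v \<in> pverts ?H"
      have "connected_in (parcs ?T) {x \<in> pverts ?T. v \<in> ?\<beta> x}"
      proof (rule connected_in_parent_graph[OF p])
        show "v \<in> {x \<in> pverts ?T. v \<in> ?\<beta> x}" using v by (simp add: parent_graph_def elimination_graph_def)
        fix x assume "x \<in> {x \<in> pverts ?T. v \<in> ?\<beta> x}" "x \<noteq> v"
        then have x: "x < N" "v \<in> P x" by (auto simp: parent_graph_def)
        then have "p x = Max (P x)" "0 < x" using Pi(1)[of x] by (auto simp: p_def)
        moreover have "v = Max (P x) \<or> v \<in> P (Max (P x))" using Pi(3)[of x] x by blast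
        moreover have "p x < N" using p x \<open>0 < x\<close> by (meson less_trans)
        ultimately show "0 < x \<and> p x \<in> {x \<in> pverts ?T. v \<in> ?\<beta> x}"
          by (auto simp: parent_graph_def)
      qed (auto simp: parent_graph_def)
      then show "Digraph_Component.connected (with_proj ?T \<restriction> {x \<in> pverts ?T. v \<in> ?\<beta> x})"
        by (rule digraph_connected_inducedI)
    qed
  qed
  then have "treewidth ?H \<le> td_width ?T ?\<beta>" by (rule treewidth_le_td_width)
  also have "\<dots> \<le> int s"
  proof -
    have "card (?\<beta> x) \<le> Suc s" if "x < N" for x
      using Pi(2)[OF that] fin[OF that] by (simp add: card_insert_if)
    then have "Max ((\<lambda>x. card (?\<beta> x)) ` {..<N}) \<le> Suc s" 
      using N by (subst Max_le_iff) (auto simp: lessThan_empty_iff)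
    then show ?thesis by (simp add: td_width_def parent_graph_def)
  qed
  finally show ?thesis .
qed

section \<open>Embedding into a strong product\<close>

text \<open>The vertices of each fibre are numbered injectively below \<open>M\<close>, and the
  number serves as second coordinate; distinct numbers are adjacent in the complete graph, so only
  the first coordinates constrain adjacency.\<close>

lemma subgraph_up_to_iso_strong_product:
  assumes G: "pair_graph G" and H: "pair_graph H"
    and f: "f ` pverts G \<subseteq> pverts H"
    and fib: "\<And>i. card {v \<in> pverts G. f v = i} \<le> M"
    and adj: "\<And>u v. (u, v) \<in> parcs G \<Longrightarrow> f u = f v \<or> (f u, f v) \<in> parcs H"
  shows "subgraph_up_to_iso G (H \<boxtimes> complete_graph M)"
proof -
  let ?F = "\<lambda>i. {v \<in> pverts G. f v = i}"
  have fin: "finite (pverts G)" and E: "parcs G \<subseteq> pverts G \<times> pverts G" "sym (parcs G)" "irrefl (parcs G)"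
    using G by (auto simp: pair_graph_iff)
  have "\<exists>h. inj_on h (?F i) \<and> h ` ?F i \<subseteq> {..<M}" for i
  proof -
    have "finite (?F i)" using fin by simp
    then obtain h where h: "bij_betw h (?F i) {0..<card (?F i)}" using ex_bij_betw_finite_nat by blast
    have "{0..<card (?F i)} \<subseteq> {..<M}" using fib[of i] by auto
    then show ?thesis using h by (auto simp: bij_betw_def)
  qed
  then have "\<exists>h. \<forall>i. inj_on (h i) (?F i) \<and> h i ` ?F i \<subseteq> {..<M}" by (intro choice allI)
  then obtain h where h: "\<And>i. inj_on (h i) (?F i)" "\<And>i. h i ` ?F i \<subseteq> {..<M}" by auto
  define \<phi> where "\<phi> v = (f v, h (f v) v)" for v
  define S where "S = \<lparr>pverts = \<phi> ` pverts G, parcs = map_prod \<phi> \<phi> ` parcs G\<rparr>"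
  have inj: "inj_on \<phi> (pverts G)"
  proof (rule inj_onI)
    fix u v assume uv: "u \<in> pverts G" "v \<in> pverts G" "\<phi> u = \<phi> v"
    then show "u = v" using inj_onD[OF h(1)[of "f u"], of u v] by (auto simp: \<phi>_def)
  qed
  have ran: "\<phi> v \<in> pverts H \<times> {..<M}" if "v \<in> pverts G" for v
    using that f h(2)[of "f v"] by (auto simp: \<phi>_def)
  let ?K = "H \<boxtimes> complete_graph M"
  have arcs: "(\<phi> u, \<phi> v) \<in> parcs ?K" if uv: "(u, v) \<in> parcs G" for u v
  proof -
    have V: "u \<in> pverts G" "v \<in> pverts G" using E(1) uv by auto
    have "u \<noteq> v" using E(3) uv by (auto simp: irrefl_def)
    then have "\<phi> u \<noteq> \<phi> v" using inj V by (auto dest: inj_onD)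
    then show ?thesis using adj[OF uv] ran[OF V(1)] ran[OF V(2)]
      by (auto simp: strong_product_def complete_graph_def \<phi>_def)
  qed
  have S: "pair_graph S"
    unfolding pair_graph_iff
  proof (intro conjI)
    show "finite (pverts S)" using fin by (simp add: S_def)
    show "parcs S \<subseteq> pverts S \<times> pverts S" using E(1) by (auto simp: S_def)
    show "sym (parcs S)" using E(2) by (force simp: S_def sym_def)
    have False if "(a, a) \<in> parcs S" for a
    proof -
      obtain u v where uv: "(u, v) \<in> parcs G" "a = \<phi> u" "a = \<phi> v"
        using \<open>(a, a) \<in> parcs S\<close> by (auto simp: S_def)
      then have "u = v" using inj E(1) by (auto dest: inj_onD)
      then show False using uv(1) E(3) by (auto simp: irrefl_def)
    qed
    then show "irrefl (parcs S)" by (auto simp: irrefl_def)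
  qed
  moreover have "subgraph (with_proj S) (with_proj ?K)"
  proof (rule subgraph_with_projI)
    show "pverts S \<subseteq> pverts ?K" 
      using ran by (simp add: S_def strong_product_def complete_graph_def image_subset_iff)
    show "parcs S \<subseteq> parcs ?K" using arcs by (auto simp: S_def)
    show "parcs S \<subseteq> pverts S \<times> pverts S" using S by (simp add: pair_graph_iff)
    show "parcs ?K \<subseteq> pverts ?K \<times> pverts ?K" by (auto simp: strong_product_def)
  qed
  moreover have "digraph_iso (with_proj G) (with_proj S)"
    using inj E(1) S_def by (rule digraph_iso_image)
  ultimately show ?thesis unfolding subgraph_up_to_iso_def by blast
qed

section \<open>Partitioning along clique models\<close>

definition attachments :: "'a rel \<Rightarrow> 'a set \<Rightarrow> 'a set \<Rightarrow> 'a set" where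
  "attachments E W C = {u \<in> W. \<exists>v\<in>C. (u, v) \<in> E}"

text \<open>The branch sets are indexed by the parts that \<open>C\<close> sees. A branch set must
  contain the vertices of its part that are adjacent to \<open>C\<close>, and may otherwise use any
  vertices outside \<open>C\<close>; the parts themselves may be disconnected.\<close>

definition clique_model ::
  "'a rel \<Rightarrow> 'a set \<Rightarrow> ('a \<Rightarrow> nat) \<Rightarrow> 'a set \<Rightarrow> 'a set \<Rightarrow> (nat \<Rightarrow> 'a set) \<Rightarrow> bool" where
  "clique_model E V f T C B \<longleftrightarrow>
    (\<forall>i\<in>f ` T. B i \<subseteq> V - C \<and> connected_in E (B i) \<and> {u \<in> T. f u = i} \<subseteq> B i) \<and>
    (\<forall>i\<in>f ` T. \<forall>j\<in>f ` T. i \<noteq> j \<longrightarrow> B i \<inter> B j = {} \<and> (\<exists>u\<in>B i. \<exists>v\<in>B j. (u, v) \<in> E))"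

text \<open>The seen parts satisfy the condition of \<open>elimination_order\<close> for the next
  index, so they can become \<open>P N\<close> when a part \<open>N\<close> is cut out of
  \<open>C\<close>.\<close>

definition rooted_component ::
  "'a rel \<Rightarrow> 'a set \<Rightarrow> nat \<Rightarrow> 'a set \<Rightarrow> ('a \<Rightarrow> nat) \<Rightarrow> (nat \<Rightarrow> nat set) \<Rightarrow> 'a set \<Rightarrow> bool" where
  "rooted_component E V s W f P C \<longleftrightarrow>
    card (f ` attachments E W C) \<le> s \<and>
    (f ` attachments E W C \<noteq> {} \<longrightarrow>
      f ` attachments E W C - {Max (f ` attachments E W C)} \<subseteq> P (Max (f ` attachments E W C))) \<and>
    (\<exists>B. clique_model E V f (attachments E W C) C B)"

definition partial_partition ::
  "'a rel \<Rightarrow> 'a set \<Rightarrow> nat \<Rightarrow> nat \<Rightarrow> 'a set \<Rightarrow> nat \<Rightarrow> ('a \<Rightarrow> nat) \<Rightarrow> (nat \<Rightarrow> nat set) \<Rightarrow> bool" where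
  "partial_partition E V s M W N f P \<longleftrightarrow>
    W \<subseteq> V \<and> f ` W \<subseteq> {..<N} \<and> elimination_order s N P \<and>
    (\<forall>i. card {v \<in> W. f v = i} \<le> M) \<and>
    (\<forall>u\<in>W. \<forall>v\<in>W. (u, v) \<in> E \<longrightarrow> f u = f v \<or> f u \<in> P (f v) \<or> f v \<in> P (f u)) \<and>
    (\<forall>C. is_component E (V - W) C \<longrightarrow> rooted_component E V s W f P C)"

text \<open>Components disjoint from \<open>C\<close> are unaffected. A new component inside
  \<open>C\<close> sees \<open>X\<close>, so \<open>N\<close> is its largest seen label and its
  other labels lie in \<open>P N\<close>: the elimination condition holds automatically. What
  remains for \<open>new\<close> is the number of seen parts and the clique model.\<close>

lemma partial_partition_add_part:
  assumes sym: "sym E" and fin: "finite V"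
    and pp: "partial_partition E V s M W N f P"
    and C: "is_component E (V - W) C"
    and X: "X \<subseteq> C" "X \<noteq> {}" "card X \<le> M"
    and f': "f' = (\<lambda>v. if v \<in> X then N else f v)"
    and new: "\<And>C'. is_component E (C - X) C' \<Longrightarrow>
      card (f' ` attachments E (W \<union> X) C') \<le> s \<and>
      (\<exists>B. clique_model E V f' (attachments E (W \<union> X) C') C' B)"
  shows "partial_partition E V s M (W \<union> X) (Suc N) f' (P(N := f ` attachments E W C))"
proof -
  let ?K = "f ` attachments E W C"
  let ?P = "P(N := ?K)"
  have W: "W \<subseteq> V" "f ` W \<subseteq> {..<N}" "elimination_order s N P" "\<And>i. card {v \<in> W. f v = i} \<le> M"
    "\<And>u v. u \<in> W \<Longrightarrow> v \<in> W \<Longrightarrow> (u, v) \<in> E \<Longrightarrow> f u = f v \<or> f u \<in> P (f v) \<or> f v \<in> P (f u)"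
    "\<And>C. is_component E (V - W) C \<Longrightarrow> rooted_component E V s W f P C"
    using pp unfolding partial_partition_def by auto
  have CV: "C \<subseteq> V - W" using C by (rule is_component_subset)
  have XW: "X \<inter> W = {}" using X(1) CV by blast
  have rC: "rooted_component E V s W f P C" using W(6) C .
  have KN: "?K \<subseteq> {..<N}" using W(2) by (auto simp: attachments_def)
  have fW: "f' v = f v" if "v \<in> W" for v using that XW by (auto simp: f')
  have fX: "f' v = N" if "v \<in> X" for v using that by (simp add: f')
  have fN: "f v < N" if "v \<in> W" for v using that W(2) by auto
  have MaxN: "Max A < N" if "A \<subseteq> {..<N}" "A \<noteq> {}" for A
    using that finite_subset[OF that(1)] by (subst Max_less_iff) auto
  show ?thesis unfolding partial_partition_def
  proof (intro conjI allI impI ballI)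
    show "W \<union> X \<subseteq> V" using W(1) X(1) CV by blast
    show "f' ` (W \<union> X) \<subseteq> {..<Suc N}" using fW fX fN by (force simp: less_Suc_eq)
    show "elimination_order s (Suc N) ?P"
      unfolding elimination_order_def
    proof (intro allI impI)
      fix i assume "i < Suc N"
      show "?P i \<subseteq> {..<i} \<and> card (?P i) \<le> s \<and> (?P i \<noteq> {} \<longrightarrow> ?P i - {Max (?P i)} \<subseteq> ?P (Max (?P i)))"
      proof (cases "i = N")
        case True
        have "?K \<noteq> {} \<longrightarrow> ?K - {Max ?K} \<subseteq> ?P (Max ?K)"
          using rC MaxN[OF KN] by (auto simp: rooted_component_def)
        then show ?thesis using True KN rC by (simp add: rooted_component_def)
      next
        case False
        then have i: "i < N" using \<open>i < Suc N\<close> by simp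
        then have Pi: "P i \<subseteq> {..<i}" "card (P i) \<le> s" "P i \<noteq> {} \<longrightarrow> P i - {Max (P i)} \<subseteq> P (Max (P i))"
          using W(3) by (auto simp: elimination_order_def)
        have "P i \<subseteq> {..<N}" using Pi(1) i by auto
        then have "P i \<noteq> {} \<longrightarrow> Max (P i) \<noteq> N" using MaxN[of "P i"] by auto
        then show ?thesis using Pi False by auto
      qed
    qed
    show "card {v \<in> W \<union> X. f' v = i} \<le> M" for i
    proof (cases "i = N")
      case True
      have "{v \<in> W \<union> X. f' v = i} = X" using True fW fX fN by force
      then show ?thesis using X(3) by simp
    next
      case False
      have "{v \<in> W \<union> X. f' v = i} = {v \<in> W. f v = i}" using False fW fX by auto
      then show ?thesis using W(4) by simp
    qed
    show "f' u = f' v \<or> f' u \<in> ?P (f' v) \<or> f' v \<in> ?P (f' u)"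
      if uv: "u \<in> W \<union> X" "v \<in> W \<union> X" "(u, v) \<in> E" for u v
    proof -
      have att: "f w \<in> ?K" if "w \<in> W" "x \<in> X" "(w, x) \<in> E" for w x
        using that X(1) by (auto simp: attachments_def)
      consider "u \<in> W" "v \<in> W" | "u \<in> W" "v \<in> X" | "u \<in> X" "v \<in> W" | "u \<in> X" "v \<in> X" using uv by auto
      then show ?thesis
      proof cases
        case 1
        then show ?thesis using W(5)[OF 1 uv(3)] fW fN[of u] fN[of v] by auto
      next
        case 2
        then show ?thesis using fW fX att uv(3) by simp
      next
        case 3
        then show ?thesis using fW fX att symD[OF sym uv(3)] by simp
      next
        case 4
        then show ?thesis using fX by simp
      qed
    qed
    fix D assume D: "is_component E (V - (W \<union> X)) D"
    note DV = is_component_subset[OF D]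
    show "rooted_component E V s (W \<union> X) f' ?P D"
    proof (cases "D \<inter> C = {}")
      case True
      have noX: "(x, y) \<notin> E" if "x \<in> D" "y \<in> X" for x y
      proof
        assume "(x, y) \<in> E"
        then have "x \<in> C"
          using is_component_step[OF C _ _ symD[OF sym]] X(1) that DV by blast
        then show False using True that by blast
      qed
      have "closed_in E (V - W) D"
        unfolding closed_in_def
      proof (intro conjI ballI impI)
        fix x y assume xy: "x \<in> D" "y \<in> V - W" "(x, y) \<in> E"
        then have "y \<notin> X" using noX by blast
        then show "y \<in> D" using is_component_step[OF D xy(1) _ xy(3)] xy(2) by blast
      qed (use DV in blast)
      then have "is_component E (V - W) D" using D by (simp add: is_component_def)
      then have rD: "rooted_component E V s W f P D" by (rule W(6))
      have T: "attachments E (W \<union> X) D = attachments E W D"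
        using noX symD[OF sym] by (auto simp: attachments_def)
      have TW: "attachments E W D \<subseteq> W" by (auto simp: attachments_def)
      have fT: "f' ` attachments E W D = f ` attachments E W D"
        using fW TW by (intro image_cong) auto
      have KD: "f ` attachments E W D \<subseteq> {..<N}" using TW W(2) by blast
      have "clique_model E V f' (attachments E W D) D B" if "clique_model E V f (attachments E W D) D B" for B
      proof -
        have "{u \<in> attachments E W D. f' u = i} = {u \<in> attachments E W D. f u = i}" for i
          using fW TW by auto
        then show ?thesis using that unfolding clique_model_def fT by simp
      qed
      then show ?thesis
        using rD MaxN[OF KD] unfolding rooted_component_def T fT by auto
    next
      case False
      have "D \<subseteq> C"
        using is_component_absorb[OF C is_component_connected[OF D] _ False] DV by blast
      moreover have "closed_in E (C - X) D"
        using D DV CV \<open>D \<subseteq> C\<close> unfolding is_component_def closed_in_def by blast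
      ultimately have DC: "is_component E (C - X) D" using D by (simp add: is_component_def)
      let ?L = "f' ` attachments E (W \<union> X) D"
      obtain x where x: "x \<in> X" using X(2) by blast
      obtain d where d: "d \<in> D" using is_component_nonempty[OF D] by blast
      have "x \<notin> D" using DV x by blast
      \<comment> \<open>\<open>C\<close> is connected and has vertices of \<open>X\<close> outside
        \<open>D\<close>, so an arc leaves \<open>D\<close> inside \<open>C\<close>; it can only end
        in \<open>X\<close>. Hence \<open>D\<close> sees the new part.\<close>
      obtain u v where uv: "u \<in> C" "u \<in> D" "v \<in> C" "v \<notin> D" "(u, v) \<in> E"
        using connected_in_crossing[OF is_component_connected[OF C] _ d _ \<open>x \<notin> D\<close>] d x X(1) \<open>D \<subseteq> C\<close>
        by blast
      have "v \<in> X" using is_component_step[OF DC uv(2) _ uv(5)] uv(3,4) by blast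
      then have "v \<in> attachments E (W \<union> X) D"
        using uv symD[OF sym uv(5)] by (auto simp: attachments_def)
      then have NL: "N \<in> ?L" using fX[OF \<open>v \<in> X\<close>] by (metis imageI)
      have LK: "?L \<subseteq> insert N ?K"
      proof
        fix i assume "i \<in> ?L"
        then obtain w where w: "w \<in> attachments E (W \<union> X) D" "i = f' w" by blast
        show "i \<in> insert N ?K"
        proof (cases "w \<in> X")
          case True
          then show ?thesis using w fX by simp
        next
          case False
          then have "w \<in> attachments E W C" using w \<open>D \<subseteq> C\<close> by (auto simp: attachments_def)
          moreover have "w \<in> W" using w False by (auto simp: attachments_def)
          ultimately show ?thesis using w(2) fW by auto
        qed
      qed
      have "finite ?K" using KN finite_subset by blast
      then have "finite ?L" using LK finite_subset by blast
      then have "Max ?L = N"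
      proof (rule Max_eqI)
        fix i assume "i \<in> ?L"
        then have "i \<in> insert N ?K" using LK by blast
        then show "i \<le> N" using KN by (auto intro: less_imp_le)
      qed (rule NL)
      then have "?L - {Max ?L} \<subseteq> ?P (Max ?L)" using LK by auto
      then show ?thesis using new[OF DC] unfolding rooted_component_def by blast
    qed
  qed
qed

text \<open>This is the interface between the partition argument and the size bounds: the three
  outcomes are a new branch set, a separator, and a forbidden packing, and \<open>M\<close> enters
  the extension step only through them.\<close>

definition hit_separate_or_pack :: "nat \<Rightarrow> nat \<Rightarrow> nat \<Rightarrow> 'a rel \<Rightarrow> 'a set \<Rightarrow> bool" where
  "hit_separate_or_pack s t M E V \<longleftrightarrow>
    (\<forall>C (K :: nat set) A. C \<subseteq> V \<and> connected_in E C \<and> finite K \<and> card K \<le> s \<and> hits K A C \<longrightarrow>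
      (card K < s \<and> (\<exists>X\<subseteq>C. connected_in E X \<and> card X \<le> M \<and> hits K A X)) \<or>
      (\<exists>Z. separates E C K A Z \<and> card Z \<le> M) \<or>
      (card K = s \<and> (\<exists>F. finite F \<and> card F = t \<and> pairwise disjnt F \<and>
         (\<forall>X\<in>F. X \<subseteq> C \<and> connected_in E X \<and> hits K A X))))"

section \<open>The extension step\<close>

lemma separator_minimal:
  assumes "separates E C K A Z" "finite C"
  obtains Y where "separates E C K A Y" "card Y \<le> card Z"
    "\<And>z. z \<in> Y \<Longrightarrow> \<not> separates E C K A (Y - {z})"
proof -
  obtain Y where Y: "separates E C K A Y" "\<And>Y'. separates E C K A Y' \<Longrightarrow> card Y \<le> card Y'"
    using ex_has_least_nat[of "separates E C K A" Z card] assms(1) by blast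
  have "finite Y" using Y(1) assms(2) finite_subset by (auto simp: separates_def)
  show ?thesis
  proof (rule that[OF Y(1) Y(2)[OF assms(1)]])
    fix z assume "z \<in> Y"
    then have "card (Y - {z}) < card Y" using \<open>finite Y\<close> by (intro psubset_card_mono) auto
    then show "\<not> separates E C K A (Y - {z})" using Y(2) by (meson not_less)
  qed
qed

lemma partial_partition_extend:
  assumes G: "pair_graph G" and t: "t \<ge> 1"
    and free: "J_minor_free s t G"
    and hsp: "hit_separate_or_pack s t M (parcs G) (pverts G)"
    and pp: "partial_partition (parcs G) (pverts G) s M W N f P"
    and "W \<noteq> pverts G"
  shows "\<exists>W' N' f' P'. partial_partition (parcs G) (pverts G) s M W' N' f' P' \<and> W \<subset> W'"
proof -
  let ?E = "parcs G" and ?V = "pverts G"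
  have fin: "finite ?V" and sym: "sym ?E" using G by (auto simp: pair_graph_iff)
  have WV: "W \<subseteq> ?V" and fN: "\<And>v. v \<in> W \<Longrightarrow> f v < N"
    using pp by (auto simp: partial_partition_def)
  obtain v0 where "v0 \<in> ?V - W" using WV assms(6) by blast
  then obtain C where C: "is_component ?E (?V - W) C" using component_exists[OF sym] by metis
  have CV: "C \<subseteq> ?V - W" and Cconn: "connected_in ?E C"
    using C is_component_subset is_component_connected by auto
  let ?T = "attachments ?E W C"
  let ?K = "f ` ?T"
  have "rooted_component ?E ?V s W f P C" using pp C by (simp add: partial_partition_def)
  then obtain B where Ks: "card ?K \<le> s" and B: "clique_model ?E ?V f ?T C B"
    by (auto simp: rooted_component_def)
  have B1: "\<And>i. i \<in> ?K \<Longrightarrow> B i \<subseteq> ?V - C" "\<And>i. i \<in> ?K \<Longrightarrow> connected_in ?E (B i)"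
    "\<And>u. u \<in> ?T \<Longrightarrow> u \<in> B (f u)"
    and B2: "\<And>i j. i \<in> ?K \<Longrightarrow> j \<in> ?K \<Longrightarrow> i \<noteq> j \<Longrightarrow> B i \<inter> B j = {}"
    and B3: "\<And>i j. i \<in> ?K \<Longrightarrow> j \<in> ?K \<Longrightarrow> i \<noteq> j \<Longrightarrow> \<exists>u\<in>B i. \<exists>v\<in>B j. (u, v) \<in> ?E"
    using B unfolding clique_model_def by blast+
  have KN: "?K \<subseteq> {..<N}" using fN by (auto simp: attachments_def)
  then have NK: "N \<notin> ?K" by blast
  have finK: "finite ?K" using KN finite_subset by blast
  define A where "A i = {v \<in> C. \<exists>u\<in>W. f u = i \<and> (u, v) \<in> ?E}" for i
  have hitC: "hits ?K A C" unfolding hits_def A_def attachments_def by blast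
  have AB: "\<exists>u\<in>B i. (u, v) \<in> ?E" if "v \<in> A i" for i v
  proof -
    from that obtain u where u: "u \<in> W" "f u = i" "(u, v) \<in> ?E" "v \<in> C" by (auto simp: A_def)
    then have "u \<in> ?T" by (auto simp: attachments_def)
    then show ?thesis using B1(3) u by blast
  qed
  \<comment> \<open>Common to both kinds of new part \<open>X\<close>: for each component
    \<open>C'\<close> of \<open>C - X\<close>, fewer than \<open>s\<close> old parts
    \<open>K'\<close> cover those that \<open>C'\<close> still sees, and \<open>D\<close> is a
    branch set for the new part, disjoint from and adjacent to the branch sets of
    \<open>K'\<close>.\<close>
  have conv: "?thesis" if X: "X \<subseteq> C" "X \<noteq> {}" "card X \<le> M"
    and new: "\<And>C'. is_component ?E (C - X) C' \<Longrightarrow>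
      \<exists>K' D. f ` attachments ?E W C' \<subseteq> K' \<and> K' \<subseteq> ?K \<and> card K' < s \<and>
        D \<subseteq> ?V - C' \<and> connected_in ?E D \<and> X \<inter> attachments ?E X C' \<subseteq> D \<and>
        (\<forall>i\<in>K'. B i \<inter> D = {} \<and> (\<exists>u\<in>B i. \<exists>v\<in>D. (u, v) \<in> ?E))" for X
  proof -
    define f' where "f' = (\<lambda>v. if v \<in> X then N else f v)"
    have XW: "X \<inter> W = {}" using X(1) CV by blast
    have "partial_partition ?E ?V s M (W \<union> X) (Suc N) f' (P(N := ?K))"
    proof (rule partial_partition_add_part[OF sym fin pp C X f'_def])
      fix C' assume C': "is_component ?E (C - X) C'"
      have C'C: "C' \<subseteq> C" using is_component_subset[OF C'] by blast
      from new[OF C'] obtain K' D where K': "f ` attachments ?E W C' \<subseteq> K'" "K' \<subseteq> ?K" "card K' < s"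
        and D: "D \<subseteq> ?V - C'" "connected_in ?E D" "X \<inter> attachments ?E X C' \<subseteq> D"
          "\<And>i. i \<in> K' \<Longrightarrow> B i \<inter> D = {}" "\<And>i. i \<in> K' \<Longrightarrow> \<exists>u\<in>B i. \<exists>v\<in>D. (u, v) \<in> ?E"
        by blast
      let ?T' = "attachments ?E (W \<union> X) C'"
      have finK': "finite K'" using K'(2) finK finite_subset by blast
      have TW: "u \<in> attachments ?E W C'" "u \<in> ?T" "f' u = f u" "u \<in> W" if "u \<in> ?T'" "u \<notin> X" for u
        using that C'C XW by (auto simp: attachments_def f'_def)
      have sub: "f' ` ?T' \<subseteq> insert N K'"
      proof
        fix i assume "i \<in> f' ` ?T'"
        then obtain u where u: "u \<in> ?T'" "i = f' u" by blast
        show "i \<in> insert N K'"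
          using TW[of u] u K'(1) by (cases "u \<in> X") (auto simp: f'_def)
      qed
      have "card (f' ` ?T') \<le> card (insert N K')" using sub finK' by (intro card_mono) auto
      also have "\<dots> \<le> s" using K'(3) finK' by (simp add: card_insert_if)
      finally have "card (f' ` ?T') \<le> s" .
      moreover have "clique_model ?E ?V f' ?T' C' (B(N := D))"
        unfolding clique_model_def
      proof (intro conjI ballI impI)
        fix i assume i: "i \<in> f' ` ?T'"
        have iK: "i = N \<or> i \<in> K'" using i sub by blast
        have "i \<in> K' \<Longrightarrow> B i \<subseteq> ?V - C'" using B1(1)[of i] K'(2) C'C by blast
        then show "(B(N := D)) i \<subseteq> ?V - C'" using iK D(1) by auto
        have "i \<in> K' \<Longrightarrow> connected_in ?E (B i)" using B1(2)[of i] K'(2) by blast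
        then show "connected_in ?E ((B(N := D)) i)" using iK D(2) by auto
        show "{u \<in> ?T'. f' u = i} \<subseteq> (B(N := D)) i"
        proof
          fix u assume u: "u \<in> {u \<in> ?T'. f' u = i}"
          show "u \<in> (B(N := D)) i"
          proof (cases "u \<in> X")
            case True
            then have "u \<in> attachments ?E X C'" "i = N" using u by (auto simp: attachments_def f'_def)
            then show ?thesis using True D(3) by auto
          next
            case False
            have u': "u \<in> ?T'" "f' u = i" using u by auto
            have "f u = i" "u \<in> ?T" "i \<noteq> N"
              using TW[OF u'(1) False] u'(2) fN by auto
            then show ?thesis using B1(3) by auto
          qed
        qed
        fix j assume j: "j \<in> f' ` ?T'" "i \<noteq> j"
        have mem: "i = N \<or> i \<in> K'" "j = N \<or> j \<in> K'" using iK j(1) sub by blast+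
        have K'N: "l \<in> K' \<Longrightarrow> l \<noteq> N" for l using K'(2) NK by blast
        show "(B(N := D)) i \<inter> (B(N := D)) j = {}"
          using mem j(2) D(4) B2[of i j] K'(2) K'N by auto
        show "\<exists>u\<in>(B(N := D)) i. \<exists>v\<in>(B(N := D)) j. (u, v) \<in> ?E"
        proof (cases "i = N")
          case True
          then have "j \<in> K'" using mem j(2) by auto
          then have "\<exists>v\<in>D. \<exists>u\<in>B j. (v, u) \<in> ?E" using D(5) symD[OF sym] by blast
          then show ?thesis using True j(2) by simp
        next
          case False
          then have "i \<in> K'" using mem by auto
          show ?thesis
          proof (cases "j = N")
            case True
            then show ?thesis using D(5)[OF \<open>i \<in> K'\<close>] False by simp
          next
            case False
            then have "j \<in> K'" using mem by auto
            then have "\<exists>u\<in>B i. \<exists>v\<in>B j. (u, v) \<in> ?E"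
              by (rule B3[OF subsetD[OF K'(2) \<open>i \<in> K'\<close>] subsetD[OF K'(2)] j(2)])
            then show ?thesis using False \<open>i \<noteq> N\<close> by simp
          qed
        qed
      qed
      ultimately show "card (f' ` ?T') \<le> s \<and> (\<exists>B. clique_model ?E ?V f' ?T' C' B)" by blast
    qed
    moreover have "W \<subset> W \<union> X" using X(2) XW by blast
    ultimately show ?thesis by blast
  qed
  have KC': "f ` attachments ?E W C' \<subseteq> ?K" if "C' \<subseteq> C" for C'
    using that by (auto simp: attachments_def)
  from hsp have "(card ?K < s \<and> (\<exists>X\<subseteq>C. connected_in ?E X \<and> card X \<le> M \<and> hits ?K A X)) \<or>
      (\<exists>Z. separates ?E C ?K A Z \<and> card Z \<le> M) \<or>
      (card ?K = s \<and> (\<exists>F. finite F \<and> card F = t \<and> pairwise disjnt F \<and>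
         (\<forall>X\<in>F. X \<subseteq> C \<and> connected_in ?E X \<and> hits ?K A X)))"
    unfolding hit_separate_or_pack_def using CV Cconn finK Ks hitC
    by (elim allE[of _ C] allE[of _ ?K] allE[of _ A]) blast
  then show ?thesis
  proof (elim disjE exE conjE)
    fix X assume X: "card ?K < s" "X \<subseteq> C" "connected_in ?E X" "card X \<le> M" "hits ?K A X"
    show ?thesis
    proof (rule conv[OF X(2) connected_in_nonempty[OF X(3)] X(4)])
      fix C' assume C': "is_component ?E (C - X) C'"
      then have "C' \<subseteq> C" "C' \<inter> X = {}" using is_component_subset by blast+
      moreover have "\<exists>u\<in>B i. \<exists>v\<in>X. (u, v) \<in> ?E" if "i \<in> ?K" for i
        using X(5) that AB unfolding hits_def by blast
      moreover have "B i \<inter> X = {}" if "i \<in> ?K" for i using B1(1)[OF that] X(2) by blast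
      moreover have "X \<subseteq> ?V - C'" using X(2) CV \<open>C' \<inter> X = {}\<close> by blast
      ultimately show "\<exists>K' D. f ` attachments ?E W C' \<subseteq> K' \<and> K' \<subseteq> ?K \<and> card K' < s \<and>
        D \<subseteq> ?V - C' \<and> connected_in ?E D \<and> X \<inter> attachments ?E X C' \<subseteq> D \<and>
        (\<forall>i\<in>K'. B i \<inter> D = {} \<and> (\<exists>u\<in>B i. \<exists>v\<in>D. (u, v) \<in> ?E))"
        using X(1,3) KC' by (intro exI[of _ ?K] exI[of _ X]) auto
    qed
  next
    fix Z0 assume Z0: "separates ?E C ?K A Z0" "card Z0 \<le> M"
    have finC: "finite C" using CV fin finite_subset by blast
    from Z0(1) finC obtain Z where Z: "separates ?E C ?K A Z" "card Z \<le> card Z0"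
      "\<And>z. z \<in> Z \<Longrightarrow> \<not> separates ?E C ?K A (Z - {z})" by (rule separator_minimal) blast
    have ZC: "Z \<subseteq> C" and Zsep: "\<And>Q. Q \<subseteq> C - Z \<Longrightarrow> connected_in ?E Q \<Longrightarrow> \<not> hits ?K A Q"
      using Z(1) by (auto simp: separates_def)
    \<comment> \<open>\<open>C\<close> itself hits all \<open>A i\<close>, so the empty set does not
      separate.\<close>
    have Zne: "Z \<noteq> {}" using Zsep[of C] Cconn hitC by auto
    show ?thesis
    proof (rule conv[OF ZC Zne])
      show "card Z \<le> M" using Z(2) Z0(2) by simp
      fix C' assume C': "is_component ?E (C - Z) C'"
      have C'C: "C' \<subseteq> C - Z" using C' by (rule is_component_subset)
      have "\<not> hits ?K A C'" using Zsep[OF C'C is_component_connected[OF C']] .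
      then obtain k where k: "k \<in> ?K" "C' \<inter> A k = {}" by (auto simp: hits_def)
      obtain b where b: "b \<in> B k" using B1(2)[OF k(1)] connected_in_nonempty by blast
      \<comment> \<open>\<open>D\<close> will be \<open>B k\<close> together with all that it
        reaches in \<open>C\<close> without entering \<open>C'\<close>. As \<open>C'\<close> does
        not see part \<open>k\<close>, the new part may take over this enlarged branch set.\<close>
      define S where "S = B k \<union> (C - C')"
      have "b \<in> S" using b by (simp add: S_def)
      then obtain D where D: "is_component ?E S D" "b \<in> D" using component_exists[OF sym] by metis
      have DS: "D \<subseteq> S" using D(1) by (rule is_component_subset)
      have BD: "B k \<subseteq> D"
        using is_component_absorb[OF D(1) B1(2)[OF k(1)]] b D(2) by (auto simp: S_def)
      \<comment> \<open>Minimality gives a connected \<open>Q\<close> that hits all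
        \<open>A i\<close> and meets \<open>Z\<close> only in \<open>z\<close>. It contains a vertex
        of \<open>A k\<close>, which is in \<open>D\<close>. On the way to \<open>z\<close> it could
        leave \<open>D\<close> only into \<open>C'\<close>, but a vertex of \<open>C - Z\<close>
        adjacent to \<open>C'\<close> already belongs to \<open>C'\<close>.\<close>
      have ZD: "z \<in> D" if z: "z \<in> Z" for z
      proof (rule ccontr)
        assume zD: "z \<notin> D"
        obtain Q where Q: "Q \<subseteq> C - (Z - {z})" "connected_in ?E Q" "hits ?K A Q"
          using Z(3)[OF z] ZC unfolding separates_def by blast
        have "z \<in> Q"
        proof (rule ccontr)
          assume "z \<notin> Q"
          then have "Q \<subseteq> C - Z" using Q(1) by blast
          then show False using Zsep Q(2,3) by blast
        qed
        obtain q where q: "q \<in> Q" "q \<in> A k" using Q(3) k(1) unfolding hits_def by blast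
        have "q \<in> S" using q k(2) Q(1) by (auto simp: S_def)
        moreover obtain u where "u \<in> B k" "(u, q) \<in> ?E" using AB[OF q(2)] by blast
        ultimately have "q \<in> D" using is_component_step[OF D(1)] BD by blast
        obtain x y where xy: "x \<in> Q" "x \<in> D" "y \<in> Q" "y \<notin> D" "(x, y) \<in> ?E"
          using connected_in_crossing[OF Q(2) q(1) \<open>q \<in> D\<close> \<open>z \<in> Q\<close> zD] .
        have "y \<notin> S" using is_component_step[OF D(1) xy(2) _ xy(5)] xy(4) by blast
        then have "y \<in> C'" using xy(3) Q(1) by (auto simp: S_def)
        moreover have "x \<in> C - Z" using xy(1,2) zD Q(1) by blast
        ultimately have "x \<in> C'" using is_component_step[OF C' _ _ symD[OF sym xy(5)]] by blast
        then show False using xy(2) DS B1(1)[OF k(1)] C'C by (auto simp: S_def)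
      qed
      have sub: "f ` attachments ?E W C' \<subseteq> ?K - {k}"
      proof
        fix i assume i: "i \<in> f ` attachments ?E W C'"
        have "i \<noteq> k"
        proof
          assume "i = k"
          then obtain u v where "u \<in> W" "f u = k" "v \<in> C'" "(u, v) \<in> ?E"
            using i by (auto simp: attachments_def)
          then have "v \<in> C' \<inter> A k" using C'C by (auto simp: A_def)
          then show False using k(2) by blast
        qed
        then show "i \<in> ?K - {k}" using i KC'[of C'] C'C by blast
      qed
      have "card (?K - {k}) < s" using Ks k(1) finK
        by (metis card_Diff1_less less_le_trans)
      moreover have "D \<subseteq> ?V - C'"
        using DS B1(1)[OF k(1)] CV C'C by (auto simp: S_def)
      moreover have "B i \<inter> D = {} \<and> (\<exists>u\<in>B i. \<exists>v\<in>D. (u, v) \<in> ?E)" if i: "i \<in> ?K - {k}" for i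
      proof
        have "B i \<inter> S = {}" using B2[of i k] B1(1)[of i] i k(1) by (auto simp: S_def)
        then show "B i \<inter> D = {}" using DS by blast
        show "\<exists>u\<in>B i. \<exists>v\<in>D. (u, v) \<in> ?E" using B3[of i k] i k(1) BD by blast
      qed
      ultimately show "\<exists>K' D. f ` attachments ?E W C' \<subseteq> K' \<and> K' \<subseteq> ?K \<and> card K' < s \<and>
        D \<subseteq> ?V - C' \<and> connected_in ?E D \<and> Z \<inter> attachments ?E Z C' \<subseteq> D \<and>
        (\<forall>i\<in>K'. B i \<inter> D = {} \<and> (\<exists>u\<in>B i. \<exists>v\<in>D. (u, v) \<in> ?E))"
        using sub ZD is_component_connected[OF D(1)]
        by (intro exI[of _ "?K - {k}"] exI[of _ D]) auto
    qed
  next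
    fix F assume F: "card ?K = s" "finite F" "card F = t" "pairwise disjnt F"
      "\<forall>X\<in>F. X \<subseteq> C \<and> connected_in ?E X \<and> hits ?K A X"
    have "\<not> J_minor_free s t G"
    proof (rule J_minor_of_models[OF G finK F(1) t _ Cconn _ _ _ F(2-4)])
      show "C \<subseteq> ?V" using CV by blast
      show "B i \<subseteq> ?V - C \<and> connected_in ?E (B i)" if "i \<in> ?K" for i using B1 that by blast
      show "X \<subseteq> C \<and> connected_in ?E X" if "X \<in> F" for X using F(5) that by blast
      show "B i \<inter> B j = {}" "\<exists>u\<in>B i. \<exists>v\<in>B j. (u, v) \<in> ?E"
        if "i \<in> ?K" "j \<in> ?K" "i \<noteq> j" for i j using B2[OF that] B3[OF that] .
      show "\<exists>u\<in>B i. \<exists>v\<in>X. (u, v) \<in> ?E" if X: "X \<in> F" and i: "i \<in> ?K" for X i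
      proof -
        have "hits ?K A X" using F(5) X by blast
        then obtain v where "v \<in> X" "v \<in> A i" using i unfolding hits_def by blast
        then show ?thesis using AB by blast
      qed
    qed
    then show ?thesis using free by blast
  qed
qed

section \<open>From single extensions to the product structure\<close>

lemma complete_partition_exists:
  assumes G: "pair_graph G" and t: "t \<ge> 1" and free: "J_minor_free s t G"
    and hsp: "hit_separate_or_pack s t M (parcs G) (pverts G)"
  shows "\<exists>N f P. partial_partition (parcs G) (pverts G) s M (pverts G) N f P"
proof -
  let ?pp = "partial_partition (parcs G) (pverts G) s M"
  have fin: "finite (pverts G)" using G by (simp add: pair_graph_iff)
  have "\<exists>N f P. ?pp (pverts G) N f P" if "?pp W N f P" for W N f P
    using that
  proof (induction "card (pverts G - W)" arbitrary: W N f P rule: less_induct)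
    case less
    show ?case
    proof (cases "W = pverts G")
      case True
      then show ?thesis using less.prems by blast
    next
      case False
      obtain W' N' f' P' where W': "?pp W' N' f' P'" "W \<subset> W'"
        using partial_partition_extend[OF G t free hsp less.prems False] by blast
      have "W' \<subseteq> pverts G" using W'(1) by (simp add: partial_partition_def)
      then have "card (pverts G - W') < card (pverts G - W)"
        using W'(2) fin by (intro psubset_card_mono) auto
      then show ?thesis using less.hyps W'(1) by blast
    qed
  qed
  moreover have "?pp {} 0 (\<lambda>_. 0) (\<lambda>_. {})"
    by (simp add: partial_partition_def elimination_order_def rooted_component_def
        attachments_def clique_model_def)
  ultimately show ?thesis by blast
qed

lemma product_structure:
  assumes G: "pair_graph G" "pverts G \<noteq> {}" and t: "t \<ge> 1" and free: "J_minor_free s t G"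
    and hsp: "hit_separate_or_pack s t M (parcs G) (pverts G)"
  shows "\<exists>H :: nat pair_pre_digraph. pair_graph H \<and> treewidth H \<le> int s \<and>
           subgraph_up_to_iso G (H \<boxtimes> complete_graph M)"
proof -
  obtain N f P where "partial_partition (parcs G) (pverts G) s M (pverts G) N f P"
    using complete_partition_exists[OF G(1) t free hsp] by blast
  then have f: "f ` pverts G \<subseteq> {..<N}" and P: "elimination_order s N P"
    and fib: "\<And>i. card {v \<in> pverts G. f v = i} \<le> M"
    and adj: "\<And>u v. u \<in> pverts G \<Longrightarrow> v \<in> pverts G \<Longrightarrow> (u, v) \<in> parcs G \<Longrightarrow>
      f u = f v \<or> f u \<in> P (f v) \<or> f v \<in> P (f u)"
    by (auto simp: partial_partition_def)
  have N: "N \<ge> 1" using f G(2) by (cases N) auto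
  have V: "parcs G \<subseteq> pverts G \<times> pverts G" using G(1) by (simp add: pair_graph_iff)
  let ?H = "elimination_graph N P"
  have "subgraph_up_to_iso G (?H \<boxtimes> complete_graph M)"
  proof (rule subgraph_up_to_iso_strong_product[OF G(1) pair_graph_elimination_graph[OF P] _ fib])
    show "f ` pverts G \<subseteq> pverts ?H" using f by (simp add: elimination_graph_def)
    fix u v assume uv: "(u, v) \<in> parcs G"
    then have "u \<in> pverts G" "v \<in> pverts G" using V by auto
    then show "f u = f v \<or> (f u, f v) \<in> parcs ?H"
      using adj[OF _ _ uv] f by (auto simp: elimination_graph_def)
  qed
  then show ?thesis
    using treewidth_elimination_graph[OF P N] pair_graph_elimination_graph[OF P] by blast
qed

section \<open>The three regimes of the bound\<close>

lemma hits_reindex: "hits (e ` I) A X \<longleftrightarrow> hits I (A \<circ> e) X"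
  by (simp add: hits_def)

lemma separates_reindex: "separates E C (e ` I) A Z \<longleftrightarrow> separates E C I (A \<circ> e) Z"
  by (simp add: separates_def hits_reindex)

lemma singleton_hits:
  assumes "finite K" "card K \<le> 1" "connected_in E C" "hits K A C"
  obtains v where "v \<in> C" "hits K A {v}"
proof -
  obtain c where c: "c \<in> C" using connected_in_nonempty[OF assms(3)] by blast
  show ?thesis
  proof (cases "K = {}")
    case True
    then show ?thesis using that[OF c] by (simp add: hits_def)
  next
    case False
    then have "card K = 1" using assms(1,2) by (simp add: card_gt_0_iff le_antisym Suc_leI)
    then obtain k where k: "K = {k}" by (rule card_1_singletonE)
    then obtain v where "v \<in> C" "v \<in> A k" using assms(4) by (auto simp: hits_def)
    then show ?thesis using that[of v] k by (simp add: hits_def)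
  qed
qed

text \<open>With one seen part, \<open>A k \<inter> C\<close> is itself a separator, and its
  vertices, taken as singletons, are a packing. Having at least \<open>t\<close> vertices or at most
  \<open>t - 1 <= M\<close> decides which of the two applies.\<close>

lemma hit_separate_or_pack_1:
  assumes "finite V" "M \<ge> 1" "t \<le> M + 1"
  shows "hit_separate_or_pack 1 t M E V"
  unfolding hit_separate_or_pack_def
proof (intro allI impI, elim conjE)
  fix C A and K :: "nat set"
  assume C: "C \<subseteq> V" "connected_in E C" and K: "finite K" "card K \<le> 1" "hits K A C"
  have finC: "finite C" using C(1) assms(1) by (rule finite_subset)
  consider "card K < 1" | "card K = 1" using K(2) by linarith
  then show "(card K < 1 \<and> (\<exists>X\<subseteq>C. connected_in E X \<and> card X \<le> M \<and> hits K A X)) \<or>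
      (\<exists>Z. separates E C K A Z \<and> card Z \<le> M) \<or>
      (card K = 1 \<and> (\<exists>F. finite F \<and> card F = t \<and> pairwise disjnt F \<and>
         (\<forall>X\<in>F. X \<subseteq> C \<and> connected_in E X \<and> hits K A X)))"
  proof cases
    case 1
    obtain v where "v \<in> C" "hits K A {v}" using singleton_hits[OF K(1,2) C(2) K(3)] .
    then show ?thesis using 1 assms(2) by (intro disjI1 conjI exI[of _ "{v}"]) auto
  next
    case 2
    then obtain k where k: "K = {k}" by (rule card_1_singletonE)
    show ?thesis
    proof (cases "t \<le> card (A k \<inter> C)")
      case True
      then obtain T where T: "T \<subseteq> A k \<inter> C" "card T = t" "finite T"
        by (meson obtain_subset_with_card_n)
      have "\<exists>F. finite F \<and> card F = t \<and> pairwise disjnt F \<and>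
         (\<forall>X\<in>F. X \<subseteq> C \<and> connected_in E X \<and> hits K A X)"
        using T by (intro exI[of _ "(\<lambda>v. {v}) ` T"])
          (auto simp: card_image inj_on_def pairwise_def k hits_def)
      then show ?thesis using 2 by blast
    next
      case False
      then have "card (A k \<inter> C) \<le> M" using assms(3) by simp
      moreover have "separates E C K A (A k \<inter> C)" by (auto simp: separates_def hits_def k)
      ultimately show ?thesis by blast
    qed
  qed
qed

text \<open>Two seen parts are the setting of Menger's theorem: without \<open>t\<close> disjoint
  connections there is a separator with at most \<open>t - 1 <= M\<close> vertices.\<close>

lemma hit_separate_or_pack_2:
  assumes "finite V" "finite E" "sym E" "M \<ge> 1" "t \<le> M + 1"
  shows "hit_separate_or_pack 2 t M E V"
  unfolding hit_separate_or_pack_def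
proof (intro allI impI, elim conjE)
  fix C A and K :: "nat set"
  assume C: "C \<subseteq> V" "connected_in E C" and K: "finite K" "card K \<le> 2" "hits K A C"
  have finC: "finite C" using C(1) assms(1) by (rule finite_subset)
  consider "card K \<le> 1" | "card K = 2" using K(2) by linarith
  then show "(card K < 2 \<and> (\<exists>X\<subseteq>C. connected_in E X \<and> card X \<le> M \<and> hits K A X)) \<or>
      (\<exists>Z. separates E C K A Z \<and> card Z \<le> M) \<or>
      (card K = 2 \<and> (\<exists>F. finite F \<and> card F = t \<and> pairwise disjnt F \<and>
         (\<forall>X\<in>F. X \<subseteq> C \<and> connected_in E X \<and> hits K A X)))"
  proof cases
    case 1
    obtain v where "v \<in> C" "hits K A {v}" using singleton_hits[OF K(1) 1 C(2) K(3)] .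
    then show ?thesis using 1 assms(4) by (intro disjI1 conjI exI[of _ "{v}"]) auto
  next
    case 2
    then obtain k l where kl: "K = {k, l}" by (auto simp: card_2_iff)
    have hK: "hits K A X \<longleftrightarrow> X \<inter> A k \<noteq> {} \<and> X \<inter> A l \<noteq> {}" for X by (auto simp: hits_def kl)
    show ?thesis
    proof (cases "\<forall>Z. separates E C UNIV (case_bool (A k) (A l)) Z \<longrightarrow> t \<le> card Z")
      case True
      then have "\<exists>F. finite F \<and> card F = t \<and> pairwise disjnt F \<and>
          (\<forall>X\<in>F. X \<subseteq> C \<and> connected_in E X \<and> X \<inter> A k \<noteq> {} \<and> X \<inter> A l \<noteq> {})"
        using menger[OF assms(2,3) finC, of "A k" "A l" t] by blast
      then show ?thesis unfolding hK[symmetric] using 2 by blast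
    next
      case False
      then obtain Z where Z: "separates E C UNIV (case_bool (A k) (A l)) Z" "card Z < t" by auto
      have "separates E C K A Z" using Z(1) unfolding separates_def hK by simp
      moreover have "card Z \<le> M" using Z(2) assms(5) by simp
      ultimately show ?thesis by blast
    qed
  qed
qed

text \<open>\<open>small\<close> serves fewer than \<open>s\<close> seen parts: with
  \<open>q = M\<close>, the separator satisfies
  \<open>card Z * Suc M <= (s - 2) * card V < Suc M * Suc M\<close>. \<open>pack\<close> serves
  exactly \<open>s\<close> seen parts: its \<open>q\<close> is such that the deleted hitting sets
  and the final separator together fit into \<open>M\<close>.\<close>

lemma hit_separate_or_pack_ge_3:
  assumes "s \<ge> 3" "finite V" "sym E" "M \<ge> 1" "t \<ge> 1"
    and small: "(s - 2) * card V < Suc M * Suc M"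
    and pack: "t \<noteq> 1 \<Longrightarrow> \<exists>q. \<forall>z. z * Suc q \<le> (s - 1) * card V \<longrightarrow> (t - 1) * q + z \<le> M"
  shows "hit_separate_or_pack s t M E V"
  unfolding hit_separate_or_pack_def
proof (intro allI impI, elim conjE)
  fix C A and K :: "nat set"
  assume C: "C \<subseteq> V" "connected_in E C" and K: "finite K" "card K \<le> s" "hits K A C"
  have finC: "finite C" using C(1) assms(2) by (rule finite_subset)
  have CV: "card C \<le> card V" using C(1) assms(2) by (rule card_mono[rotated])
  let ?packing = "\<exists>F. finite F \<and> card F = t \<and> pairwise disjnt F \<and>
         (\<forall>X\<in>F. X \<subseteq> C \<and> connected_in E X \<and> hits K A X)"
  have reindex: "\<exists>e. K = e ` {..card K - 1}" if "card K \<ge> 2"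
  proof -
    have "{..card K - 1} = {0..<card K}" using that by auto
    then show ?thesis using ex_bij_betw_nat_finite[OF K(1)] by (auto simp: bij_betw_def)
  qed
  consider "card K \<le> 1" | "2 \<le> card K" "card K < s" | "card K = s" "t = 1" | "card K = s" "t \<noteq> 1"
    using K(2) by linarith
  then show "(card K < s \<and> (\<exists>X\<subseteq>C. connected_in E X \<and> card X \<le> M \<and> hits K A X)) \<or>
      (\<exists>Z. separates E C K A Z \<and> card Z \<le> M) \<or> (card K = s \<and> ?packing)"
  proof cases
    case 1
    obtain v where "v \<in> C" "hits K A {v}" using singleton_hits[OF K(1) 1 C(2) K(3)] .
    then show ?thesis using 1 assms(1,4) by (intro disjI1 conjI exI[of _ "{v}"]) auto
  next
    case 2
    then obtain e where e: "K = e ` {..card K - 1}" using reindex by blast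
    have "card K - 1 \<ge> 1" using 2 by simp
    from finC assms(3) this show ?thesis
    proof (rule connected_hitting_set_or_separator[where q = M and A = "A \<circ> e"])
      fix X assume X: "X \<subseteq> C" "connected_in E X" "card X \<le> M" "hits {..card K - 1} (A \<circ> e) X"
      then have "hits K A X" using e hits_reindex by metis
      then show ?thesis using X 2 by blast
    next
      fix Z assume Z: "separates E C {..card K - 1} (A \<circ> e) Z" "card Z * Suc M \<le> (card K - 1) * card C"
      have "card Z * Suc M \<le> (s - 2) * card V"
        using Z(2) mult_le_mono[OF _ CV, of "card K - 1" "s - 2"] 2 by linarith
      then have "card Z * Suc M < Suc M * Suc M" using small by simp
      then have "card Z \<le> M" by (metis less_Suc_eq_le mult_less_cancel2)
      moreover have "separates E C K A Z" using Z(1) e separates_reindex by metis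
      ultimately show ?thesis by blast
    qed
  next
    case 3
    \<comment> \<open>A packing of size 1 is \<open>C\<close> itself.\<close>
    have ?packing using 3 C K(3) by (intro exI[of _ "{C}"]) auto
    then show ?thesis using 3 by blast
  next
    case 4
    then obtain e where e: "K = e ` {..card K - 1}" using reindex assms(1) by auto
    obtain q where q: "\<And>z. z * Suc q \<le> (s - 1) * card V \<Longrightarrow> (t - 1) * q + z \<le> M" using pack[OF 4(2)] by blast
    have "card K - 1 \<ge> 1" using 4 assms(1) by simp
    from finC assms(3) this show ?thesis
    proof (rule disjoint_hitting_sets_or_separator[where q = q and A = "A \<circ> e" and p = "t - 1"])
      fix F assume F: "finite F" "card F = Suc (t - 1)" "pairwise disjnt F"
        "\<And>X. X \<in> F \<Longrightarrow> X \<subseteq> C \<and> connected_in E X \<and> card X \<le> q \<and> hits {..card K - 1} (A \<circ> e) X"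
      have "hits K A X" if "X \<in> F" for X using F(4)[OF that] e hits_reindex by metis
      then have ?packing using F assms(5) by (intro exI[of _ F]) simp
      then show ?thesis using 4 by blast
    next
      fix Z z assume Z: "separates E C {..card K - 1} (A \<circ> e) Z" "card Z \<le> (t - 1) * q + z"
        "z * Suc q \<le> (card K - 1) * card C"
      have "(card K - 1) * card C \<le> (s - 1) * card V" using CV 4 by simp
      then have "card Z \<le> M" using q[of z] Z(2,3) by linarith
      moreover have "separates E C K A Z" using Z(1) e separates_reindex by metis
      ultimately show ?thesis by blast
    qed
  qed
qed

text \<open>The real number \<open>r = sqrt (a / b)\<close> makes both \<open>b * r\<close> and
  \<open>a / r\<close> equal to \<open>sqrt (a * b)\<close>. Rounding \<open>r\<close> down to
  \<open>q\<close> keeps \<open>b * q\<close> within this value, and dividing by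
  \<open>Suc q > r\<close> keeps \<open>z\<close> within it.\<close>

lemma packing_bound:
  fixes a b :: nat
  assumes "a \<ge> 1" "b \<ge> 1"
  shows "\<exists>q. \<forall>z. z * Suc q \<le> a \<longrightarrow> b * q + z \<le> nat \<lfloor>2 * sqrt (real a * real b)\<rfloor>"
proof -
  define w where "w = sqrt (real a * real b)"
  define r where "r = w / real b"
  define q where "q = nat \<lfloor>r\<rfloor>"
  have w: "w > 0" "w * w = real a * real b" using assms by (auto simp: w_def)
  have r: "r > 0" "real b * r = w" "r * w = real a"
    using w assms by (auto simp: r_def field_simps)
  have q: "real q \<le> r" "r < real q + 1" unfolding q_def using r(1) by auto
  have "b * q + z \<le> nat \<lfloor>2 * w\<rfloor>" if z: "z * Suc q \<le> a" for z
  proof -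
    have "real z * r \<le> real z * (real q + 1)" using q(2) by (intro mult_left_mono) auto
    also have "\<dots> = real (z * Suc q)" by (simp add: algebra_simps)
    also have "\<dots> \<le> r * w" using z r(3) by (simp only: of_nat_le_iff)
    finally have "real z \<le> w" using r(1) by (simp add: mult.commute)
    moreover have "real b * real q \<le> w" using mult_left_mono[OF q(1), of "real b"] r(2) by simp
    ultimately have "real (b * q + z) \<le> 2 * w" by simp
    then show ?thesis by (simp add: le_nat_floor)
  qed
  then show ?thesis unfolding w_def by blast
qed

theorem theorem22:
  fixes s t n :: nat and m :: real and G :: "'a pair_pre_digraph"
  assumes "s \<ge> 1" and "t \<ge> 1" and "n \<ge> 1"
    and "m = (if s \<in> {1, 2} then max (real t - 1) 1
              else if t = 1 then sqrt ((real s - 2) * real n)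
              else 2 * sqrt ((real s - 1) * (real t - 1) * real n))"
    and "pair_graph G" and "card (pverts G) = n"
    and "J_minor_free s t G"
  shows "\<exists>H :: nat pair_pre_digraph. pair_graph H \<and> treewidth H \<le> int s \<and>
           subgraph_up_to_iso G (H \<boxtimes> complete_graph (nat \<lfloor>m\<rfloor>))"
proof -
  let ?M = "nat \<lfloor>m\<rfloor>"
  have fin: "finite (pverts G)" and sym: "sym (parcs G)" and "parcs G \<subseteq> pverts G \<times> pverts G"
    using assms(5) by (auto simp: pair_graph_iff)
  then have finE: "finite (parcs G)" by (auto intro: finite_subset)
  have "hit_separate_or_pack s t ?M (parcs G) (pverts G)"
  proof (cases "s \<in> {1, 2}")
    case True
    then have m: "m = max (real t - 1) 1" using assms(4) by simp
    \<comment> \<open>Here \<open>m\<close> is an integer and at least \<open>t - 1\<close>, so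
      rounding down loses nothing.\<close>
    have "?M \<ge> 1" "t \<le> ?M + 1" using m le_nat_floor[of 1 m] le_nat_floor[of "t - 1" m] assms(2)
      by (auto simp: of_nat_diff)
    then show ?thesis
      using True hit_separate_or_pack_1[OF fin] hit_separate_or_pack_2[OF fin finE sym] by auto
  next
    case False
    then have s: "s \<ge> 3" using assms(1) by auto
    have s': "real (s - 2) = real s - 2" "real (s - 1) = real s - 1" "real (t - 1) = real t - 1"
      using s assms(2) by (auto simp: of_nat_diff)
    have one: "1 \<le> (s - 2) * n" using s assms(3) by simp
    have m0: "m \<ge> 0" using assms s by (auto simp: max_def)
    \<comment> \<open>For \<open>t > 1\<close>, \<open>m * m\<close> is 4 (s - 1)(t - 1) n, which
      dominates (s - 2) n; so the bound for fewer than \<open>s\<close> seen parts holds in both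
      cases.\<close>
    have m2: "real ((s - 2) * n) \<le> m * m"
    proof (cases "t = 1")
      case True
      then show ?thesis using assms(4) False s by (simp add: s')
    next
      case t: False
      have "m * m = 4 * real ((s - 1) * (t - 1) * n)"
        using assms(4) False t s assms(2) by (simp add: s' mult.assoc)
      moreover have "(s - 2) * n \<le> (s - 1) * (t - 1) * n"
        using t assms(2) by (intro mult_le_mono1) (cases "t - 1"; simp)
      then have "real ((s - 2) * n) \<le> real ((s - 1) * (t - 1) * n)" by (simp only: of_nat_le_iff)
      ultimately show ?thesis by linarith
    qed
    show ?thesis
    proof (rule hit_separate_or_pack_ge_3[OF s fin sym _ assms(2)])
      have "1 \<le> m * m" using m2 one by (metis of_nat_1 of_nat_le_iff order_trans)
      then have "1 \<le> m" using m0 mult_strict_mono'[of m 1 m 1] by (cases "m < 1") auto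
      then show "1 \<le> ?M" using le_nat_floor[of 1 m] by simp
      \<comment> \<open>One more than the floor exceeds \<open>m\<close>; this turns
        \<open>m2\<close> into the strict inequality between naturals.\<close>
      have "m < real (Suc ?M)" using m0 by (simp add: of_nat_nat) linarith
      then have "m * m < real (Suc ?M) * real (Suc ?M)" using m0 by (intro mult_strict_mono) auto
      then have "real ((s - 2) * n) < real (Suc ?M * Suc ?M)" using m2 by (simp only: of_nat_mult)
      then show "(s - 2) * card (pverts G) < Suc ?M * Suc ?M"
        unfolding assms(6) by (simp only: of_nat_less_iff)
      assume t: "t \<noteq> 1"
      have "m = 2 * sqrt (real ((s - 1) * n) * real (t - 1))"
        using assms(4) False t unfolding of_nat_mult s' by (simp add: ac_simps)
      then show "\<exists>q. \<forall>z. z * Suc q \<le> (s - 1) * card (pverts G) \<longrightarrow> (t - 1) * q + z \<le> ?M"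
        using packing_bound[of "(s - 1) * n" "t - 1"] s t assms(2,3) unfolding assms(6) by simp
    qed
  qed
  moreover have "pverts G \<noteq> {}" using assms(3,6) by auto
  ultimately show ?thesis using product_structure[OF assms(5) _ assms(2,7)] by blast
qed

end
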